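(* Let $d\ge1$ and let $\{\Lambda_n:n\ge1\}$ be subsets of $\mathbb Z^d$ such that each $\Lambda_n$ is finite and connected (in the nearest-neighbour graph $\mathbb Z^d$), $\mathbf 0\in\Lambda_n$ for all $n$, and $\operatorname{card}(\Lambda_n)\to\infty$. Consider the Edwards–Anderson model with Hamiltonian $$\mathcal H_n(\mathbf X^n;\boldsymbol\sigma)=-\sum_{\{i,j\}\subseteq\Lambda_n:\ \|i-j\|_1=1}X_{n,\{i,j\}}\sigma_i\sigma_j,$$ where the disorder variables $\mathbf X^n=\{X_{n,\{i,j\}}:i,j\in\Lambda_n,\ \|i-j\|_1=1\}$ are i.i.d. with common distribution $\mathcal P$ on $\mathbb R$ having zero mean and a density $f$ satisfying the rejection assumption of the context. Then the problem sequence of minimizing $\mathcal H_n(\mathbf X^n;\boldsymbol\sigma)$ over $\boldsymbol\sigma\in\mathcal S_n$ is stable under small perturbations for both of the following choices of perturbation blocks: 1. $\mathcal J_n=\{J_{n,\{i,j\}}:i,j\in\Lambda_n,\ \|i-j\|_1=1\}$, where $J_{n,\{i,j\}}=\{\{i,j\}\}$; 2. $\mathcal J_n=\{J_{n,i}:i\in\Lambda_n\}$, where $J_{n,i}=\{\{i,j\}:j\in\Lambda_n,\ \|j-i\|_1=1\}$.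
   Context: Parameter space: $\mathcal S_n=\{\boldsymbol\sigma=(\sigma_i)_{i\in\Lambda_n}:\sigma_{\mathbf 0}=+1,\ \sigma_i\in\{+1,-1\}\text{ for }i\in\Lambda_n\setminus\{\mathbf 0\}\}$, with metric $$d_n(\boldsymbol\sigma,\boldsymbol\sigma')=\Bigl(\frac1{\operatorname{card}(\Lambda_n)}\sum_{\{i,j\}\subseteq\Lambda_n:\|i-j\|_1=1}(\sigma_i\sigma_j-\sigma_i'\sigma_j')^2\Bigr)^{1/2}.$$ The input index set is $I_n=\{\{i,j\}:i,j\in\Lambda_n,\ \|i-j\|_1=1\}$. The minimizer over $\mathcal S_n$ is almost surely unique, denoted $\widehat{\boldsymbol\sigma}(\mathbf X^n)$. Rejection assumption: for $X\sim\mathcal P$ and $W\sim N(0,1)$ independent and any $p,s\ge0$, $\mathbb E\bigl[|W|^p\bigl(1-f(X+sW)/f(X)\bigr)_+\bigr]\le C(f,p)\,s$, with $C(f,p)$ a finite positive constant depending only on $f$ and $p$. Stability. $\mathcal J_n=\{J_{n,l}:l\in\mathcal L_n\}$ is a finite family of subsets of $I_n$ with union $I_n$; $m_n=\operatorname{card}(\mathcal L_n)$. For each $l$, $\mathbf X^{n,l}$ is an independent copy of $\mathbf X^n$ (no further assumption on the joint law over $l$), and $\mathbf X^n_l$ is $\mathbf X^n$ with the coordinates in $J_{n,l}$ replaced by those of $\mathbf X^{n,l}$. For a metric $\mathsf d$, $P(T,\mathsf d,\varepsilon)$ is the largest cardinality of a subset of $T$ with pairwise distances $>\varepsilon$. With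 $\mathcal O_{n,A}=\{\widehat{\boldsymbol\sigma}(\mathbf X^n_l):l\in A\}$, the sequence is stable under small perturbations with perturbation blocks $\mathcal J_n$ if for any $\varepsilon,\delta>0$ there is $M(\varepsilon,\delta)<\infty$ with $\limsup_{n\to\infty}\mathbb P[\min_{A\subseteq\mathcal L_n:|A|>(1-\varepsilon)m_n}P(\mathcal O_{n,A},d_n,\varepsilon)\ge M(\varepsilon,\delta)]\le\delta$. *)

theory Defs
  imports "HOL-Probability.Probability"
begin

section \<open>Finite subgraphs of the nearest-neighbour lattice\<close>

definition neighbours :: "int ^ 'd \<Rightarrow> int ^ 'd \<Rightarrow> bool" where
  "neighbours i j \<longleftrightarrow> (\<Sum>k\<in>UNIV. \<bar>(i - j) $ k\<bar>) = 1"

definition edges :: "(int ^ 'd) set \<Rightarrow> (int ^ 'd) set set" where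
  "edges \<Lambda> = {{i, j} | i j. i \<in> \<Lambda> \<and> j \<in> \<Lambda> \<and> neighbours i j}"

definition lattice_connected :: "(int ^ 'd) set \<Rightarrow> bool" where
  "lattice_connected \<Lambda> \<longleftrightarrow>
     (\<forall>i\<in>\<Lambda>. \<forall>j\<in>\<Lambda>. (i, j) \<in> {(a, b). a \<in> \<Lambda> \<and> b \<in> \<Lambda> \<and> neighbours a b}\<^sup>*)"

section \<open>The Edwards--Anderson model\<close>

text \<open>Configurations are extensional functions (\<open>undefined\<close> off \<open>\<Lambda>\<close>), so that there are
  finitely many of them when \<open>\<Lambda>\<close> is finite.\<close>

definition spin_configs :: "(int ^ 'd) set \<Rightarrow> (int ^ 'd \<Rightarrow> real) set" where
  "spin_configs \<Lambda> = {\<sigma> \<in> \<Lambda> \<rightarrow>\<^sub>E {1, -1}. \<sigma> 0 = 1}"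

text \<open>Neighbours are distinct, so for an edge \<open>e = {i, j}\<close> the product \<open>\<Prod>k\<in>e. \<sigma> k\<close> is
  \<open>\<sigma> i * \<sigma> j\<close>.\<close>

definition EA_hamiltonian ::
    "(int ^ 'd) set \<Rightarrow> ((int ^ 'd) set \<Rightarrow> real) \<Rightarrow> (int ^ 'd \<Rightarrow> real) \<Rightarrow> real" where
  "EA_hamiltonian \<Lambda> x \<sigma> = - (\<Sum>e\<in>edges \<Lambda>. x e * (\<Prod>k\<in>e. \<sigma> k))"

definition EA_dist ::
    "(int ^ 'd) set \<Rightarrow> (int ^ 'd \<Rightarrow> real) \<Rightarrow> (int ^ 'd \<Rightarrow> real) \<Rightarrow> real" where
  "EA_dist \<Lambda> \<sigma> \<tau> =
     sqrt (1 / real (card \<Lambda>) * (\<Sum>e\<in>edges \<Lambda>. ((\<Prod>k\<in>e. \<sigma> k) - (\<Prod>k\<in>e. \<tau> k))\<^sup>2))"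

section \<open>The rejection assumption on a density\<close>

text \<open>The product measure is the joint law of independent \<open>X\<close> (with density \<open>f\<close>) and
  \<open>W\<close> (standard normal).  The points where \<open>f (fst z) = 0\<close>, or where \<open>snd z = 0\<close> and hence
  \<open>0 powr 0 = 0\<close>, form a null set.  For \<open>f\<close> nonnegative and measurable the integrand is
  dominated by \<open>\<bar>W\<bar> powr p\<close>, hence integrable.\<close>

definition rejection_condition :: "(real \<Rightarrow> real) \<Rightarrow> bool" where
  "rejection_condition f \<longleftrightarrow>
     (\<forall>p\<ge>0. \<exists>C>0. \<forall>s\<ge>0.
        (\<integral>z. \<bar>snd z\<bar> powr p * max 0 (1 - f (fst z + s * snd z) / f (fst z))
          \<partial>(density lborel (\<lambda>x. ennreal (f x)) \<Otimes>\<^sub>M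
             density lborel (\<lambda>x. ennreal (std_normal_density x)))) \<le> C * s)"

section \<open>Stability under small perturbations\<close>

definition independent_copy ::
    "'w measure \<Rightarrow> 'e set \<Rightarrow> ('e \<Rightarrow> 'w \<Rightarrow> real) \<Rightarrow> ('e \<Rightarrow> 'w \<Rightarrow> real) \<Rightarrow> bool" where
  "independent_copy M I X Y \<longleftrightarrow>
     prob_space.indep_var M
       (\<Pi>\<^sub>M e\<in>I. borel) (\<lambda>\<omega>. \<lambda>e\<in>I. X e \<omega>) (\<Pi>\<^sub>M e\<in>I. borel) (\<lambda>\<omega>. \<lambda>e\<in>I. Y e \<omega>) \<and>
     distr M (\<Pi>\<^sub>M e\<in>I. borel) (\<lambda>\<omega>. \<lambda>e\<in>I. Y e \<omega>) =
     distr M (\<Pi>\<^sub>M e\<in>I. borel) (\<lambda>\<omega>. \<lambda>e\<in>I. X e \<omega>)"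

text \<open>Only meant for finite \<open>T\<close>.\<close>

definition packing_number :: "'s set \<Rightarrow> ('s \<Rightarrow> 's \<Rightarrow> real) \<Rightarrow> real \<Rightarrow> nat" where
  "packing_number T \<rho> \<epsilon> = Max {card U | U. U \<subseteq> T \<and> pairwise (\<lambda>x y. \<rho> x y > \<epsilon>) U}"

definition perturbation_blocks :: "'e set \<Rightarrow> 'l set \<Rightarrow> ('l \<Rightarrow> 'e set) \<Rightarrow> bool" where
  "perturbation_blocks I L J \<longleftrightarrow> finite L \<and> (\<forall>l\<in>L. J l \<subseteq> I) \<and> (\<Union>l\<in>L. J l) = I"

text \<open>\<open>H n x\<close> is the cost function over the finite parameter space \<open>S n\<close> with metric \<open>\<rho> n\<close>
  for the input \<open>x\<close>, \<open>X n\<close> is the random input, and \<open>Y n l\<close> is meant to be an independent copy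
  of \<open>X n\<close>, for each \<open>l \<in> L n\<close>.  In case of ties, \<open>arg_min_on\<close> makes a choice that depends only
  on the set of minimizers, so the event below is measurable whenever all \<open>H n x \<sigma>\<close> are
  measurable in \<open>x\<close>.\<close>

definition stable_under_small_perturbations ::
    "(nat \<Rightarrow> 'w measure) \<Rightarrow> (nat \<Rightarrow> 's set) \<Rightarrow> (nat \<Rightarrow> 's \<Rightarrow> 's \<Rightarrow> real) \<Rightarrow>
     (nat \<Rightarrow> ('e \<Rightarrow> real) \<Rightarrow> 's \<Rightarrow> real) \<Rightarrow> (nat \<Rightarrow> 'e \<Rightarrow> 'w \<Rightarrow> real) \<Rightarrow>
     (nat \<Rightarrow> 'l set) \<Rightarrow> (nat \<Rightarrow> 'l \<Rightarrow> 'e set) \<Rightarrow> (nat \<Rightarrow> 'l \<Rightarrow> 'e \<Rightarrow> 'w \<Rightarrow> real) \<Rightarrow> bool" where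
  "stable_under_small_perturbations M S \<rho> H X L J Y \<longleftrightarrow>
     (let opt = (\<lambda>n l \<omega>. arg_min_on
                   (H n (override_on (\<lambda>e. X n e \<omega>) (\<lambda>e. Y n l e \<omega>) (J n l))) (S n));
          minpack = (\<lambda>n \<epsilon> \<omega>. Min {packing_number ((\<lambda>l. opt n l \<omega>) ` A) (\<rho> n) \<epsilon> | A.
                       A \<subseteq> L n \<and> real (card A) > (1 - \<epsilon>) * real (card (L n))})
      in \<forall>\<epsilon>>0. \<forall>\<delta>>0. \<exists>K::real.
           limsup (\<lambda>n. ereal (measure (M n) {\<omega> \<in> space (M n). real (minpack n \<epsilon> \<omega>) \<ge> K}))
             \<le> ereal \<delta>)"

section \<open>The two families of blocks\<close>

definition edge_block :: "(int ^ 'd) set \<Rightarrow> (int ^ 'd) set set" where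
  "edge_block e = {e}"

definition vertex_block :: "(int ^ 'd) set \<Rightarrow> int ^ 'd \<Rightarrow> (int ^ 'd) set set" where
  "vertex_block \<Lambda> i = {{i, j} | j. j \<in> \<Lambda> \<and> neighbours j i}"

lemma neighbours_sym: "neighbours i j \<longleftrightarrow> neighbours j i"
  by (simp add: neighbours_def abs_minus_commute)

lemma finite_edges: "finite \<Lambda> \<Longrightarrow> finite (edges \<Lambda>)"
  by (rule finite_subset[of _ "Pow \<Lambda>"]) (auto simp: edges_def)

lemma perturbation_blocks_edge:
  "finite \<Lambda> \<Longrightarrow> perturbation_blocks (edges \<Lambda>) (edges \<Lambda>) edge_block"
  by (auto simp: perturbation_blocks_def edge_block_def finite_edges)

lemma perturbation_blocks_vertex:
  assumes "finite \<Lambda>"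
  shows "perturbation_blocks (edges \<Lambda>) \<Lambda> (vertex_block \<Lambda>)"
proof -
  have "(\<Union>i\<in>\<Lambda>. vertex_block \<Lambda> i) = edges \<Lambda>"
    unfolding vertex_block_def edges_def using neighbours_sym by blast
  then show ?thesis
    using assms by (auto simp: perturbation_blocks_def)
qed

end

theory Submission
  imports Defs "HOL-Library.Ramsey"
begin

text \<open>Let \<open>m x\<close> be the ground state energy for the disorder \<open>x\<close>.  By Markov's inequality, all but an
  \<open>\<epsilon>\<close>-fraction of the perturbed minimizers have energy at most \<open>m X + O(1)\<close> with high probability, so it
  suffices that with high probability there are not many \<open>\<epsilon>\<close>-separated configurations of such an energy.
  Let \<open>X'\<close> arise from \<open>X\<close> by one Metropolis step at every edge, with proposal \<open>X + s W\<close>, where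
  \<open>s = 1 / sqrt (card \<Lambda>)\<close> and \<open>W\<close> is Gaussian.  Then \<open>X'\<close> has the law of \<open>X\<close>, so that
  \<open>E m X = E m X'\<close>, and by the rejection assumption \<open>E m X' \<le> E m (X + s W) + O(1)\<close>.  Always
  \<open>E\<^sub>W m (x + s W) \<le> m x\<close>; but if \<open>x\<close> has \<open>K\<close> separated near-ground states, then their energies fluctuate
  like a separated Gaussian family, whose expected supremum tends to infinity with \<open>K\<close>, and
  \<open>E\<^sub>W m (x + s W)\<close> is smaller than \<open>m x\<close> by any prescribed amount.  Hence such \<open>x\<close> are rare.\<close>

section \<open>The expected supremum of a separated Gaussian family\<close>

text \<open>The obstacle is that the laws of \<open>X\<close> and \<open>X + s W\<close> cannot be
  compared directly: the rejection assumption bounds the expected number of rejections only by a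
  multiple of \<open>s * card \<Lambda>\<close>, which is of order
  \<open>sqrt (card \<Lambda>)\<close>. What can be compared are the mean ground energies, because a
  rejection at \<open>e\<close> changes the ground energy by at most \<open>s\<close> times the
  modulus of \<open>W e\<close>. The total cost is then \<open>s * card E * (C * s)\<close> for the
  edge set \<open>E\<close>, which is \<open>C * card E / card \<Lambda>\<close> and hence bounded
  by the vertex degree. The same \<open>s\<close> gives every Gaussian energy the variance
  \<open>card E / card \<Lambda>\<close> and makes the Gaussian distances equal to
  \<open>EA_dist\<close>. This balance dictates the scale. If \<open>G\<close> is the set of
  disorders with many near-ground states of excess \<open>B\<close>, and \<open>\<Psi>\<close> is
  the guaranteed Gaussian supremum, the gain \<open>(\<Psi> - B) * P G\<close> cannot exceed the
  cost. No rate in \<open>K\<close> is asked of the supremum, so Ramsey's theorem and a second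
  moment suffice for it.\<close>

definition std_gauss :: "real measure" where
  "std_gauss = density lborel (\<lambda>x. ennreal (std_normal_density x))"

definition gauss :: "'i set \<Rightarrow> ('i \<Rightarrow> real) measure" where
  "gauss I = (\<Pi>\<^sub>M e\<in>I. std_gauss)"

definition dot_on :: "'i set \<Rightarrow> ('i \<Rightarrow> real) \<Rightarrow> ('i \<Rightarrow> real) \<Rightarrow> real" where
  "dot_on I u v = (\<Sum>e\<in>I. u e * v e)"

lemma sets_std_gauss [measurable_cong, simp]: "sets std_gauss = sets borel"
  by (simp add: std_gauss_def)

lemma space_std_gauss [simp]: "space std_gauss = UNIV"
  by (simp add: std_gauss_def)

lemma prob_space_std_gauss: "prob_space std_gauss"
  unfolding std_gauss_def by (rule prob_space_normal_density) simp

interpretation gauss: product_sigma_finite "\<lambda>_. std_gauss"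
  by (simp add: product_sigma_finite_def prob_space_std_gauss prob_space_imp_sigma_finite)

lemma prob_space_gauss: "prob_space (gauss I)"
  unfolding gauss_def by (intro prob_space_PiM prob_space_std_gauss)

lemma sets_gauss [measurable_cong]: "sets (gauss I) = sets (\<Pi>\<^sub>M e\<in>I. borel)"
  unfolding gauss_def by (intro sets_PiM_cong) auto

lemma dot_on_commute: "dot_on I u v = dot_on I v u"
  by (simp add: dot_on_def mult.commute)

lemma dot_on_add_left: "dot_on I (\<lambda>e. u e + v e) w = dot_on I u w + dot_on I v w"
  by (simp add: dot_on_def distrib_right sum.distrib)

lemma dot_on_add_right: "dot_on I w (\<lambda>e. u e + v e) = dot_on I w u + dot_on I w v"
  by (simp add: dot_on_def distrib_left sum.distrib)

lemma dot_on_diff_left: "dot_on I (\<lambda>e. u e - v e) w = dot_on I u w - dot_on I v w"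
  by (simp add: dot_on_def left_diff_distrib sum_subtractf)

lemma dot_on_diff_right: "dot_on I w (\<lambda>e. u e - v e) = dot_on I w u - dot_on I w v"
  by (simp add: dot_on_def right_diff_distrib sum_subtractf)

lemma dot_on_scale_left: "dot_on I (\<lambda>e. a * u e) w = a * dot_on I u w"
  by (simp add: dot_on_def sum_distrib_left mult.assoc)

lemma dot_on_scale_right: "dot_on I w (\<lambda>e. a * u e) = a * dot_on I w u"
  by (simp add: dot_on_def sum_distrib_left algebra_simps)

lemma dot_on_sum_right: "dot_on I w (\<lambda>e. \<Sum>k\<in>J. u k e) = (\<Sum>k\<in>J. dot_on I w (u k))"
  by (simp add: dot_on_def sum_distrib_left) (rule sum.swap)

lemma dot_on_self_nonneg: "0 \<le> dot_on I u u"
  by (simp add: dot_on_def sum_nonneg)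

lemma dot_on_parallelogram:
  "dot_on I (\<lambda>e. u e - v e) (\<lambda>e. u e - v e) \<le> 2 * dot_on I u u + 2 * dot_on I v v"
proof -
  have "0 \<le> dot_on I (\<lambda>e. u e + v e) (\<lambda>e. u e + v e)" by (rule dot_on_self_nonneg)
  then show ?thesis
    by (simp add: dot_on_add_left dot_on_add_right dot_on_diff_left dot_on_diff_right dot_on_commute[of I v u])
qed

lemma dot_on_abs_le:
  assumes "dot_on I u u \<le> c" "dot_on I v v \<le> c"
  shows "\<bar>dot_on I u v\<bar> \<le> c"
proof -
  have "0 \<le> dot_on I (\<lambda>e. u e + v e) (\<lambda>e. u e + v e)" "0 \<le> dot_on I (\<lambda>e. u e - v e) (\<lambda>e. u e - v e)"
    by (rule dot_on_self_nonneg)+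
  with assms show ?thesis
    by (simp add: dot_on_add_left dot_on_add_right dot_on_diff_left dot_on_diff_right dot_on_commute[of I v u])
qed

section \<open>Exponential and first moments of Gaussian vectors\<close>

lemma
  shows integrable_std_gauss_exp: "integrable std_gauss (\<lambda>x. exp (t * x))"
    and integral_std_gauss_exp: "(\<integral>x. exp (t * x) \<partial>std_gauss) = exp (t\<^sup>2 / 2)"
proof -
  \<comment> \<open>Completing the square: tilting by \<open>exp (t * x)\<close> moves the mean of
    the normal density to \<open>t\<close>.\<close>
  have eq: "std_normal_density x * exp (t * x) = exp (t\<^sup>2 / 2) * normal_density t 1 x" for x
    unfolding normal_density_def
    by (simp add: exp_add[symmetric] exp_diff[symmetric] field_simps power2_eq_square)
  show "integrable std_gauss (\<lambda>x. exp (t * x))"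
    unfolding std_gauss_def by (subst integrable_density) (auto simp: eq)
  have "(\<integral>x. exp (t * x) \<partial>std_gauss) = (\<integral>x. exp (t\<^sup>2 / 2) * normal_density t 1 x \<partial>lborel)"
    unfolding std_gauss_def by (subst integral_density) (auto simp: eq)
  also have "\<dots> = exp (t\<^sup>2 / 2)"
    by simp
  finally show "(\<integral>x. exp (t * x) \<partial>std_gauss) = exp (t\<^sup>2 / 2)" .
qed

lemma
  shows integrable_std_gauss_id: "integrable std_gauss (\<lambda>x. x)"
    and integral_std_gauss_id: "(\<integral>x. x \<partial>std_gauss) = 0"
proof -
  have i: "integrable lborel (\<lambda>x. std_normal_density x * (x - 0) ^ (2 * 0 + 1))"
    using integrable.intros[OF normal_moment_odd[of 1 0 0]] by simp
  show "integrable std_gauss (\<lambda>x. x)"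
    unfolding std_gauss_def using i by (subst integrable_density) auto
  show "(\<integral>x. x \<partial>std_gauss) = 0"
    unfolding std_gauss_def using has_bochner_integral_integral_eq[OF normal_moment_odd[of 1 0 0]]
    by (subst integral_density) auto
qed

lemma
  assumes "finite I"
  shows integrable_gauss_exp_dot_on: "integrable (gauss I) (\<lambda>w. exp (dot_on I u w))"
    and integral_gauss_exp_dot_on: "(\<integral>w. exp (dot_on I u w) \<partial>gauss I) = exp (dot_on I u u / 2)"
proof -
  have eq: "exp (dot_on I u w) = (\<Prod>e\<in>I. exp (u e * w e))" for w
    by (simp add: dot_on_def exp_sum assms)
  show "integrable (gauss I) (\<lambda>w. exp (dot_on I u w))"
    unfolding eq gauss_def
    by (intro gauss.product_integrable_prod assms integrable_std_gauss_exp)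
  have "(\<integral>w. exp (dot_on I u w) \<partial>gauss I) = (\<Prod>e\<in>I. exp ((u e)\<^sup>2 / 2))"
    unfolding eq gauss_def
    by (subst gauss.product_integral_prod) (auto simp: assms integrable_std_gauss_exp integral_std_gauss_exp)
  also have "\<dots> = exp (dot_on I u u / 2)"
    by (simp add: exp_sum[symmetric] assms dot_on_def sum_divide_distrib power2_eq_square)
  finally show "(\<integral>w. exp (dot_on I u w) \<partial>gauss I) = exp (dot_on I u u / 2)" .
qed

lemma
  fixes \<phi> :: "real \<Rightarrow> real"
  assumes e: "e \<in> I" and \<phi>: "\<phi> \<in> borel_measurable borel"
  shows integrable_gauss_component: "integrable std_gauss \<phi> \<Longrightarrow> integrable (gauss I) (\<lambda>w. \<phi> (w e))"
    and integral_gauss_component: "(\<integral>w. \<phi> (w e) \<partial>gauss I) = (\<integral>x. \<phi> x \<partial>std_gauss)"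
proof -
  have eq: "distr (gauss I) std_gauss (\<lambda>w. w e) = std_gauss"
    unfolding gauss_def by (rule distr_PiM_component[OF prob_space_std_gauss e])
  have m: "(\<lambda>w. w e) \<in> gauss I \<rightarrow>\<^sub>M std_gauss"
    unfolding gauss_def using e by measurable
  show "integrable std_gauss \<phi> \<Longrightarrow> integrable (gauss I) (\<lambda>w. \<phi> (w e))"
    using integrable_distr[OF m, of \<phi>] eq by simp
  show "(\<integral>w. \<phi> (w e) \<partial>gauss I) = (\<integral>x. \<phi> x \<partial>std_gauss)"
    using integral_distr[OF m, of \<phi>] \<phi> eq by simp
qed

lemma
  shows integrable_gauss_dot_on: "integrable (gauss I) (\<lambda>w. dot_on I u w)"
    and integral_gauss_dot_on: "(\<integral>w. dot_on I u w \<partial>gauss I) = 0"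
proof -
  have i: "e \<in> I \<Longrightarrow> integrable (gauss I) (\<lambda>w. u e * w e)" for e
    by (intro integrable_mult_right integrable_gauss_component integrable_std_gauss_id) auto
  then show "integrable (gauss I) (\<lambda>w. dot_on I u w)"
    by (simp add: dot_on_def)
  have "(\<integral>w. dot_on I u w \<partial>gauss I) = (\<Sum>e\<in>I. \<integral>w. u e * w e \<partial>gauss I)"
    unfolding dot_on_def by (rule Bochner_Integration.integral_sum) (rule i)
  also have "\<dots> = 0"
    using integral_gauss_component[of _ I "\<lambda>x. x"] by (simp add: integral_std_gauss_id)
  finally show "(\<integral>w. dot_on I u w \<partial>gauss I) = 0" .
qed

text \<open>A second moment bound shows that the average \<open>Z\<close> of \<open>exp (\<beta> \<langle>z k, w\<rangle> - \<beta>\<^sup>2 |z k|\<^sup>2 / 2)\<close> is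
  concentrated at \<open>1\<close>, and \<open>Z \<ge> 1 / 2\<close> forces \<open>\<langle>z k, w\<rangle> \<ge> \<beta> |z k|\<^sup>2 / 2 - ln 2 / \<beta>\<close> for some \<open>k\<close>.\<close>

lemma gauss_second_moment:
  fixes z :: "'k \<Rightarrow> 'i \<Rightarrow> real"
  assumes I: "finite I" and T: "finite T" "T \<noteq> {}"
    and upper: "\<And>k. k \<in> T \<Longrightarrow> dot_on I (z k) (z k) \<le> r"
    and lower: "\<And>k. k \<in> T \<Longrightarrow> \<rho> \<le> dot_on I (z k) (z k)"
    and off: "\<And>k l. k \<in> T \<Longrightarrow> l \<in> T \<Longrightarrow> k \<noteq> l \<Longrightarrow> dot_on I (z k) (z l) \<le> \<kappa>"
    and \<beta>: "0 < \<beta>" "exp (\<beta>\<^sup>2 * r) / card T \<le> 1 / 16" "exp (\<beta>\<^sup>2 * \<kappa>) \<le> 17 / 16"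
    and L: "0 \<le> L" "L \<le> \<beta> * \<rho> / 2 - ln 2 / \<beta>"
    and h: "integrable (gauss I) h"
      "\<And>w k. w \<in> space (gauss I) \<Longrightarrow> k \<in> T \<Longrightarrow> dot_on I (z k) w \<le> h w"
  shows "L / 2 - 2 * exp (r / 2) \<le> (\<integral>w. h w \<partial>gauss I)"
proof -
  interpret g: prob_space "gauss I" by (rule prob_space_gauss)
  define m where "m = real (card T)"
  have m: "m > 0" using T by (simp add: m_def card_gt_0_iff)
  define Z where "Z w = (\<Sum>k\<in>T. exp (dot_on I (\<lambda>e. \<beta> * z k e) w) * exp (- (\<beta>\<^sup>2 * dot_on I (z k) (z k) / 2))) / m" for w
  obtain k0 where k0: "k0 \<in> T" using T by auto
  \<comment> \<open>Where \<open>Z w < 1 / 2\<close>, only a single coordinate bounds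
    \<open>h\<close> from below: \<open>h w\<close> is at least \<open>t w\<close>, hence at least
    \<open>- exp (t w) - exp (- t w)\<close>, and each exponential has expectation at most
    \<open>exp (r / 2)\<close>.\<close>
  define t where "t w = dot_on I (z k0) w" for w
  have intZ: "integrable (gauss I) Z"
    unfolding Z_def by (intro integrable_divide_zero Bochner_Integration.integrable_sum integrable_mult_left integrable_gauss_exp_dot_on I)
  have EZ: "(\<integral>w. Z w \<partial>gauss I) = 1"
  proof -
    have "(\<integral>w. Z w \<partial>gauss I) = (\<Sum>k\<in>T. \<integral>w. exp (dot_on I (\<lambda>e. \<beta> * z k e) w) * exp (- (\<beta>\<^sup>2 * dot_on I (z k) (z k) / 2)) \<partial>gauss I) / m"
      unfolding Z_def
      by (simp add: Bochner_Integration.integral_sum integrable_gauss_exp_dot_on I)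
    also have "\<dots> = (\<Sum>k\<in>T. 1) / m"
    proof -
      have "(\<integral>w. exp (dot_on I (\<lambda>e. \<beta> * z k e) w) * exp (- (\<beta>\<^sup>2 * dot_on I (z k) (z k) / 2)) \<partial>gauss I) = 1" for k
        unfolding integral_mult_left_zero integral_gauss_exp_dot_on[OF I]
        by (simp add: dot_on_scale_left dot_on_scale_right exp_add[symmetric] power2_eq_square)
      then show ?thesis by simp
    qed
    finally show ?thesis using m by (simp add: m_def)
  qed
  define V where "V k l = dot_on I (z k) (z k) + dot_on I (z l) (z l)" for k l
  have Z2: "(Z w)\<^sup>2 = (\<Sum>k\<in>T. \<Sum>l\<in>T. exp (dot_on I (\<lambda>e. \<beta> * (z k e + z l e)) w) * exp (- (\<beta>\<^sup>2 * V k l / 2))) / m\<^sup>2" for w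
  proof -
    have "exp (dot_on I (\<lambda>e. \<beta> * z k e) w) * exp (- (\<beta>\<^sup>2 * dot_on I (z k) (z k) / 2)) *
      (exp (dot_on I (\<lambda>e. \<beta> * z l e) w) * exp (- (\<beta>\<^sup>2 * dot_on I (z l) (z l) / 2))) =
      exp (dot_on I (\<lambda>e. \<beta> * (z k e + z l e)) w) * exp (- (\<beta>\<^sup>2 * V k l / 2))" for k l
      by (simp add: dot_on_scale_left dot_on_add_left V_def exp_add[symmetric] field_simps)
    then show ?thesis
      by (simp add: Z_def power_divide power2_eq_square[of "sum _ _"] sum_product)
  qed
  have intZ2: "integrable (gauss I) (\<lambda>w. (Z w)\<^sup>2)"
    unfolding Z2 by (intro integrable_divide_zero Bochner_Integration.integrable_sum integrable_mult_left integrable_gauss_exp_dot_on I)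
  have EZ2: "(\<integral>w. (Z w)\<^sup>2 \<partial>gauss I) = (\<Sum>k\<in>T. \<Sum>l\<in>T. exp (\<beta>\<^sup>2 * dot_on I (z k) (z l))) / m\<^sup>2"
  proof -
    have "(\<integral>w. (Z w)\<^sup>2 \<partial>gauss I) = (\<Sum>k\<in>T. \<Sum>l\<in>T. \<integral>w. exp (dot_on I (\<lambda>e. \<beta> * (z k e + z l e)) w) * exp (- (\<beta>\<^sup>2 * V k l / 2)) \<partial>gauss I) / m\<^sup>2"
      unfolding Z2
      by (simp add: Bochner_Integration.integral_sum Bochner_Integration.integrable_sum integrable_gauss_exp_dot_on I)
    also have "\<dots> = (\<Sum>k\<in>T. \<Sum>l\<in>T. exp (\<beta>\<^sup>2 * dot_on I (z k) (z l))) / m\<^sup>2"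
    proof -
      have "(\<integral>w. exp (dot_on I (\<lambda>e. \<beta> * (z k e + z l e)) w) * exp (- (\<beta>\<^sup>2 * V k l / 2)) \<partial>gauss I)
        = exp (\<beta>\<^sup>2 * dot_on I (z k) (z l))" for k l
        unfolding integral_mult_left_zero integral_gauss_exp_dot_on[OF I]
        by (simp add: dot_on_scale_left dot_on_scale_right dot_on_add_left dot_on_add_right
            V_def exp_add[symmetric] power2_eq_square dot_on_commute[of I "z l" "z k"] field_simps)
      then show ?thesis by simp
    qed
    finally show ?thesis .
  qed
  \<comment> \<open>The diagonal contributes at most 1/16 and the other pairs at most 17/16, so
    \<open>Z\<close> has variance at most 1/8.\<close>
  have EZ2_le: "(\<integral>w. (Z w)\<^sup>2 \<partial>gauss I) \<le> 9 / 8"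
  proof -
    have "(\<Sum>l\<in>T. exp (\<beta>\<^sup>2 * dot_on I (z k) (z l))) \<le> m / 16 + m * (17 / 16)" if k: "k \<in> T" for k
    proof -
      have "(\<Sum>l\<in>T. exp (\<beta>\<^sup>2 * dot_on I (z k) (z l)))
        = exp (\<beta>\<^sup>2 * dot_on I (z k) (z k)) + (\<Sum>l\<in>T - {k}. exp (\<beta>\<^sup>2 * dot_on I (z k) (z l)))"
        by (rule sum.remove) (use T k in auto)
      moreover have "exp (\<beta>\<^sup>2 * dot_on I (z k) (z k)) \<le> exp (\<beta>\<^sup>2 * r)"
        using upper[OF k] by (simp add: mult_left_mono)
      moreover have "exp (\<beta>\<^sup>2 * r) \<le> m / 16"
        using \<beta>(2) m by (simp add: m_def field_simps)
      moreover have "(\<Sum>l\<in>T - {k}. exp (\<beta>\<^sup>2 * dot_on I (z k) (z l))) \<le> (\<Sum>l\<in>T - {k}. 17 / 16)"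
      proof (rule sum_mono)
        fix l assume l: "l \<in> T - {k}"
        have "\<beta>\<^sup>2 * dot_on I (z k) (z l) \<le> \<beta>\<^sup>2 * \<kappa>"
          using off[OF k, of l] l by (auto intro: mult_left_mono)
        then have "exp (\<beta>\<^sup>2 * dot_on I (z k) (z l)) \<le> exp (\<beta>\<^sup>2 * \<kappa>)"
          by (rule exp_le_cancel_iff[THEN iffD2])
        then show "exp (\<beta>\<^sup>2 * dot_on I (z k) (z l)) \<le> 17 / 16" using \<beta>(3) by (rule order_trans)
      qed
      moreover have "(\<Sum>l\<in>T - {k}. 17 / 16 :: real) \<le> m * (17 / 16)"
        using card_Diff1_le[of T k] by (simp add: m_def)
      ultimately show ?thesis by linarith
    qed
    then have "(\<Sum>k\<in>T. \<Sum>l\<in>T. exp (\<beta>\<^sup>2 * dot_on I (z k) (z l))) \<le> (\<Sum>k\<in>T. m / 16 + m * (17 / 16))"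
      by (rule sum_mono)
    also have "\<dots> = 9 / 8 * m\<^sup>2"
      by (simp add: m_def power2_eq_square algebra_simps)
    finally show ?thesis unfolding EZ2 using m by (simp add: divide_le_eq)
  qed
  have Z1: "(Z w - 1)\<^sup>2 = (Z w)\<^sup>2 - 2 * Z w + 1" for w
    by (simp add: power2_eq_square algebra_simps)
  have int_t: "integrable (gauss I) (\<lambda>w. exp (t w))" "integrable (gauss I) (\<lambda>w. exp (- t w))"
    and E_t: "(\<integral>w. exp (t w) \<partial>gauss I) \<le> exp (r / 2)" "(\<integral>w. exp (- t w) \<partial>gauss I) \<le> exp (r / 2)"
  proof -
    have neg: "- t w = dot_on I (\<lambda>e. (-1) * z k0 e) w" for w
      by (simp only: t_def dot_on_scale_left)
    show "integrable (gauss I) (\<lambda>w. exp (t w))"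
      unfolding t_def by (rule integrable_gauss_exp_dot_on[OF I])
    show "integrable (gauss I) (\<lambda>w. exp (- t w))"
      unfolding neg by (rule integrable_gauss_exp_dot_on[OF I])
    show "(\<integral>w. exp (t w) \<partial>gauss I) \<le> exp (r / 2)"
      unfolding t_def integral_gauss_exp_dot_on[OF I] using upper[OF k0] by simp
    show "(\<integral>w. exp (- t w) \<partial>gauss I) \<le> exp (r / 2)"
      unfolding neg integral_gauss_exp_dot_on[OF I] using upper[OF k0] by (simp add: dot_on_def)
  qed
  \<comment> \<open>Chebyshev's inequality in functional form: \<open>L\<close> times one minus four
    times the squared deviation of \<open>Z\<close> from 1 is at most \<open>L\<close> everywhere
    and at most 0 where \<open>Z w < 1 / 2\<close>; by the variance bound its mean is at least
    \<open>L / 2\<close>. The square is expanded so that it can be integrated term by term.\<close>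
  define F where "F w = L * (1 - 4 * ((Z w)\<^sup>2 - 2 * Z w + 1)) - exp (t w) - exp (- t w)" for w
  have pointwise: "F w \<le> h w" if w: "w \<in> space (gauss I)" for w
  proof (cases "Z w \<ge> 1 / 2")
    case True
    have "\<exists>k\<in>T. exp (dot_on I (\<lambda>e. \<beta> * z k e) w) * exp (- (\<beta>\<^sup>2 * dot_on I (z k) (z k) / 2)) \<ge> 1 / 2"
    proof (rule ccontr)
      assume "\<not> ?thesis"
      then have "(\<Sum>k\<in>T. exp (dot_on I (\<lambda>e. \<beta> * z k e) w) * exp (- (\<beta>\<^sup>2 * dot_on I (z k) (z k) / 2))) < (\<Sum>k\<in>T. 1 / 2)"
        by (intro sum_strict_mono T) auto
      then have "Z w < 1 / 2"
        using m by (simp add: Z_def m_def field_simps)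
      with True show False by simp
    qed
    then obtain k where k: "k \<in> T" and "exp (dot_on I (\<lambda>e. \<beta> * z k e) w) * exp (- (\<beta>\<^sup>2 * dot_on I (z k) (z k) / 2)) \<ge> 1 / 2"
      by blast
    then have "1 / 2 \<le> exp (\<beta> * dot_on I (z k) w - \<beta>\<^sup>2 * dot_on I (z k) (z k) / 2)"
      by (simp add: dot_on_scale_left exp_add[symmetric])
    then have "ln (1 / 2) \<le> ln (exp (\<beta> * dot_on I (z k) w - \<beta>\<^sup>2 * dot_on I (z k) (z k) / 2))"
      by (intro ln_mono) auto
    moreover have "\<beta> * (\<beta> * dot_on I (z k) (z k) / 2 - ln 2 / \<beta>) = \<beta>\<^sup>2 * dot_on I (z k) (z k) / 2 - ln 2"
      using \<beta>(1) by (simp add: right_diff_distrib power2_eq_square)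
    ultimately have "\<beta> * (\<beta> * dot_on I (z k) (z k) / 2 - ln 2 / \<beta>) \<le> \<beta> * dot_on I (z k) w"
      by (simp add: ln_div)
    then have "dot_on I (z k) w \<ge> \<beta> * dot_on I (z k) (z k) / 2 - ln 2 / \<beta>"
      using \<beta>(1) by simp
    moreover have "\<beta> * \<rho> \<le> \<beta> * dot_on I (z k) (z k)"
      using lower[OF k] \<beta>(1) by simp
    ultimately have "L \<le> h w"
      using h(2)[OF w k] L(2) by linarith
    moreover have "F w \<le> L"
    proof -
      have "L * (1 - 4 * (Z w - 1)\<^sup>2) \<le> L * 1"
        using L(1) by (intro mult_left_mono) auto
      then show ?thesis using exp_gt_zero[of "t w"] exp_gt_zero[of "- t w"]
        unfolding F_def Z1 by linarith
    qed
    ultimately show ?thesis by simp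
  next
    case False
    have "(Z w - 1)\<^sup>2 \<ge> (1 / 2)\<^sup>2"
      using False by (subst power2_commute) (intro power_mono, auto)
    then have "L * (1 - 4 * (Z w - 1)\<^sup>2) \<le> 0"
      using L(1) by (intro mult_nonneg_nonpos) (auto simp: power2_eq_square)
    moreover have "t w \<le> h w" using h(2)[OF w k0] by (simp add: t_def)
    moreover have "- t w \<le> exp (- t w)" using exp_ge_add_one_self[of "- t w"] by linarith
    ultimately show ?thesis using exp_gt_zero[of "t w"] unfolding F_def Z1 by linarith
  qed
  have intF: "integrable (gauss I) F"
    unfolding F_def by (intro Bochner_Integration.integrable_diff Bochner_Integration.integrable_add integrable_mult_right int_t intZ intZ2 g.integrable_const)
  have "(\<integral>w. F w \<partial>gauss I) \<le> (\<integral>w. h w \<partial>gauss I)"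
    by (intro integral_mono intF h(1) pointwise)
  moreover have "(\<integral>w. F w \<partial>gauss I) = L * (1 - 4 * ((\<integral>w. (Z w)\<^sup>2 \<partial>gauss I) - 2 * 1 + 1))
      - (\<integral>w. exp (t w) \<partial>gauss I) - (\<integral>w. exp (- t w) \<partial>gauss I)"
    unfolding F_def
    by (simp add: int_t intZ intZ2 EZ g.prob_space Bochner_Integration.integral_diff Bochner_Integration.integral_add)
  moreover have "L * (1 - 4 * ((\<integral>w. (Z w)\<^sup>2 \<partial>gauss I) - 2 * 1 + 1)) \<ge> L * (1 / 2)"
    using EZ2_le L(1) by (intro mult_left_mono) auto
  ultimately show ?thesis using E_t by linarith
qed

text \<open>Pairs are coloured by the interval of length \<open>\<eta>\<close> that contains their
  value under \<open>g\<close>; a monochromatic set is then the required one. \<open>K\<close>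
  depends only on \<open>c\<close>, \<open>\<eta>\<close> and \<open>m\<close>, so it serves all
  \<open>U\<close> and \<open>g\<close> at once.\<close>

lemma ramsey_almost_constant:
  fixes c \<eta> :: real
  assumes "0 < \<eta>"
  obtains K :: nat where
    "\<And>(U :: 'k set) g. finite U \<Longrightarrow> K \<le> card U \<Longrightarrow> (\<And>x y. g x y = g y x) \<Longrightarrow>
       (\<And>x y. x \<in> U \<Longrightarrow> y \<in> U \<Longrightarrow> \<bar>g x y\<bar> \<le> c) \<Longrightarrow>
       \<exists>H a. H \<subseteq> U \<and> card H = m \<and> - c \<le> a \<and>
         (\<forall>x\<in>H. \<forall>y\<in>H. x \<noteq> y \<longrightarrow> a \<le> g x y \<and> g x y \<le> a + \<eta>)"
proof -
  \<comment> \<open>The number of half-open intervals of length \<open>\<eta>\<close>, starting at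
    \<open>- c\<close>, that cover everything up to \<open>c\<close>; the \<open>Suc\<close>
    accounts for the right end point.\<close>
  define q where "q = Suc (nat \<lfloor>2 * c / \<eta>\<rfloor>)"
  obtain K :: nat where K: "partn_lst {..<K} (replicate q m) 2"
    using ramsey_full by blast
  show ?thesis
  proof (rule that[of K])
    fix U :: "'k set" and g
    assume U: "finite U" "K \<le> card U" and sym: "\<And>x y. g x y = g y x"
      and bd: "\<And>x y. x \<in> U \<Longrightarrow> y \<in> U \<Longrightarrow> \<bar>g x y\<bar> \<le> c"
    obtain U' where U': "U' \<subseteq> U" "card U' = K" "finite U'"
      using U(2) obtain_subset_with_card_n by metis
    obtain h where h: "bij_betw h {..<K} U'"
      using ex_bij_betw_nat_finite[OF U'(3)] U'(2) by (auto simp: atLeast0LessThan)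
    have hU: "h i \<in> U" if "i < K" for i
      using h U'(1) that by (auto simp: bij_betw_def)
    \<comment> \<open>A colour must be a function of the unordered pair: \<open>Min\<close> and
      \<open>Max\<close> choose an order, which the symmetry of \<open>g\<close> makes
      irrelevant.\<close>
    define colour where "colour e = nat \<lfloor>(g (h (Min e)) (h (Max e)) + c) / \<eta>\<rfloor>" for e :: "nat set"
    have col: "colour {i, j} = nat \<lfloor>(g (h i) (h j) + c) / \<eta>\<rfloor>" for i j
      using sym by (cases "i \<le> j") (auto simp: colour_def min_def max_def)
    have "colour \<in> nsets {..<K} 2 \<rightarrow> {..<length (replicate q m)}"
    proof
      fix e assume "e \<in> nsets {..<K} 2"
      then obtain i j where ij: "e = {i, j}" "i < K" "j < K"
        by (auto elim: nsets2_E)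
      have "g (h i) (h j) + c \<le> 2 * c"
        using bd[OF hU hU, of i j] ij by auto
      then have "(g (h i) (h j) + c) / \<eta> \<le> 2 * c / \<eta>"
        using assms by (simp add: divide_right_mono)
      then show "colour e \<in> {..<length (replicate q m)}"
        unfolding ij(1) col by (simp add: q_def less_Suc_eq_le nat_mono floor_mono)
    qed
    then obtain i where i: "i < q" and "monochromatic {..<K} (replicate q m ! i) 2 colour i"
      using K unfolding partn_lst_def by force
    then obtain H where H: "H \<in> nsets {..<K} m" "colour ` nsets H 2 \<subseteq> {i}"
      by (auto simp: monochromatic_def)
    have HK: "H \<subseteq> {..<K}" "card H = m"
      using H(1) by (auto simp: nsets_def)
    have "a \<le> g (h x) (h y) \<and> g (h x) (h y) \<le> a + \<eta>"
      if a: "a = i * \<eta> - c" and xy: "x \<in> H" "y \<in> H" "x \<noteq> y" for a x y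
    proof -
      have "{x, y} \<in> nsets H 2" using xy by simp
      then have "colour {x, y} = i" using H(2) by blast
      moreover have "\<bar>g (h x) (h y)\<bar> \<le> c"
        using bd[OF hU hU, of x y] xy HK by auto
      then have "(g (h x) (h y) + c) / \<eta> \<ge> 0"
        using assms by (intro divide_nonneg_pos) auto
      ultimately have "\<lfloor>(g (h x) (h y) + c) / \<eta>\<rfloor> = int i"
        unfolding col by linarith
      then have "i \<le> (g (h x) (h y) + c) / \<eta>" "(g (h x) (h y) + c) / \<eta> < i + 1"
        by linarith+
      then show ?thesis using assms by (simp add: a field_simps)
    qed
    then have "\<forall>x\<in>h ` H. \<forall>y\<in>h ` H. x \<noteq> y \<longrightarrow> i * \<eta> - c \<le> g x y \<and> g x y \<le> i * \<eta> - c + \<eta>"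
      by blast
    moreover have "h ` H \<subseteq> U" using HK hU by auto
    moreover have "card (h ` H) = m"
      using HK h card_image[of h H] by (auto simp: bij_betw_def dest: inj_on_subset)
    moreover have "- c \<le> i * \<eta> - c" using assms by simp
    ultimately show "\<exists>H a. H \<subseteq> U \<and> card H = m \<and> - c \<le> a \<and>
         (\<forall>x\<in>H. \<forall>y\<in>H. x \<noteq> y \<longrightarrow> a \<le> g x y \<and> g x y \<le> a + \<eta>)" by blast
  qed
qed

text \<open>A weak form of Sudakov's minoration.  By Ramsey's theorem many of the vectors have nearly equal
  mutual inner products; centring some of them at the mean \<open>y\<close> of others makes them nearly orthogonal,
  and the shift does not change the mean of the supremum.\<close>

lemma gauss_supremum_unbounded:
  fixes \<Psi> c \<epsilon> :: real
  assumes \<epsilon>: "0 < \<epsilon>" and c: "0 \<le> c"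
  shows "\<exists>K :: nat. \<forall>(I :: 'i set) (U :: 'k set) v h.
    finite I \<longrightarrow> finite U \<longrightarrow> K \<le> card U \<longrightarrow>
    (\<forall>k\<in>U. dot_on I (v k) (v k) \<le> c) \<longrightarrow>
    (\<forall>k\<in>U. \<forall>l\<in>U. k \<noteq> l \<longrightarrow> \<epsilon>\<^sup>2 \<le> dot_on I (\<lambda>e. v k e - v l e) (\<lambda>e. v k e - v l e)) \<longrightarrow>
    integrable (gauss I) h \<longrightarrow> (\<forall>w\<in>space (gauss I). \<forall>k\<in>U. dot_on I (v k) w \<le> h w) \<longrightarrow>
    \<Psi> \<le> (\<integral>w. h w \<partial>gauss I)"
proof -
  \<comment> \<open>The second moment bound will give \<open>L / 2 - 2 * exp (4 * c / 2)\<close>,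
    where \<open>4 * c\<close> bounds the squared norms after centring; this \<open>L\<close> makes
    it equal to the modulus of \<open>\<Psi>\<close>.\<close>
  define L where "L = 2 * (\<bar>\<Psi>\<bar> + 2 * exp (2 * c))"
  have L0: "L \<ge> 0" by (simp add: L_def)
  \<comment> \<open>The centred vectors will have squared norm at least
    \<open>\<epsilon>\<^sup>2 / 4\<close>, so half of \<open>\<beta>\<close> times that norm is at
    least \<open>L + 1\<close>, and the spare 1 absorbs \<open>ln 2 / \<beta>\<close>.\<close>
  define \<beta> where "\<beta> = 1 + 8 * (L + 1) / \<epsilon>\<^sup>2"
  have \<beta>1: "1 \<le> \<beta>" using L0 by (simp add: \<beta>_def)
  have L: "L \<le> \<beta> * (\<epsilon>\<^sup>2 / 4) / 2 - ln 2 / \<beta>"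
  proof -
    have "ln 2 / \<beta> \<le> ln 2 / 1" using \<beta>1 by (intro divide_left_mono) auto
    moreover have "0 \<le> \<epsilon>\<^sup>2 / 8" by simp
    moreover have "ln 2 \<le> (1::real)" using ln_le_minus_one[of "2::real"] by simp
    moreover have "\<beta> * (\<epsilon>\<^sup>2 / 4) / 2 = \<epsilon>\<^sup>2 / 8 + (L + 1)" using \<epsilon> by (simp add: \<beta>_def field_simps)
    ultimately show ?thesis by linarith
  qed
  \<comment> \<open>Inner products after centring will be at most \<open>4 * \<eta>\<close>, and
    \<open>exp (\<beta>\<^sup>2 * (4 * \<eta>))\<close> is exactly 17/16.\<close>
  define \<eta> where "\<eta> = ln (17 / 16) / (4 * \<beta>\<^sup>2)"
  have \<eta>: "0 < \<eta>" using \<beta>1 by (simp add: \<eta>_def)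
  \<comment> \<open>The first lower bound makes \<open>c / m \<le> \<eta>\<close>; the second makes
    the diagonal share of the second moment at most 1/16.\<close>
  obtain m :: nat where m: "max (c / \<eta>) (16 * exp (\<beta>\<^sup>2 * (4 * c))) < m"
    using reals_Archimedean2 by blast
  have m0: "0 < real m" using m less_trans[of 0 "16 * exp (\<beta>\<^sup>2 * (4 * c))" "real m"] by simp
  have cm: "c / m \<le> \<eta>" using m m0 \<eta> by (simp add: field_simps)
  \<comment> \<open>Of the \<open>2 * m + 1\<close> vectors, \<open>m\<close> are spent on the mean
    \<open>y\<close> and one more may become too short, which leaves at least
    \<open>m\<close>.\<close>
  obtain K where K: "\<And>(U :: 'k set) g. finite U \<Longrightarrow> K \<le> card U \<Longrightarrow> (\<And>x y. g x y = g y x) \<Longrightarrow>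
       (\<And>x y. x \<in> U \<Longrightarrow> y \<in> U \<Longrightarrow> \<bar>g x y\<bar> \<le> c) \<Longrightarrow>
       \<exists>H a. H \<subseteq> U \<and> card H = 2 * m + 1 \<and> - c \<le> a \<and>
         (\<forall>x\<in>H. \<forall>y\<in>H. x \<noteq> y \<longrightarrow> a \<le> g x y \<and> g x y \<le> a + \<eta>)"
    using ramsey_almost_constant[OF \<eta>, where 'k = 'k and c = c and m = "2 * m + 1"] by blast
  show ?thesis
  proof (intro exI[of _ K] allI impI)
    fix I :: "'i set" and U :: "'k set" and v h
    assume I: "finite I" and U: "finite U" "K \<le> card U"
      and norm': "\<forall>k\<in>U. dot_on I (v k) (v k) \<le> c"
      and sep': "\<forall>k\<in>U. \<forall>l\<in>U. k \<noteq> l \<longrightarrow> \<epsilon>\<^sup>2 \<le> dot_on I (\<lambda>e. v k e - v l e) (\<lambda>e. v k e - v l e)"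
      and h: "integrable (gauss I) h" and h_ge': "\<forall>w\<in>space (gauss I). \<forall>k\<in>U. dot_on I (v k) w \<le> h w"
    note norm = norm'[rule_format] and sep = sep'[rule_format] and h_ge = h_ge'[rule_format]
    obtain H a where H: "H \<subseteq> U" "card H = 2 * m + 1" "- c \<le> a"
      and near: "\<And>x y. x \<in> H \<Longrightarrow> y \<in> H \<Longrightarrow> x \<noteq> y \<Longrightarrow> a \<le> dot_on I (v x) (v y) \<and> dot_on I (v x) (v y) \<le> a + \<eta>"
      using K[OF U, of "\<lambda>x y. dot_on I (v x) (v y)"] dot_on_commute dot_on_abs_le[OF norm norm] by metis
    obtain J where J: "J \<subseteq> H" "card J = m" "finite J"
      using obtain_subset_with_card_n[of m H] H(2) by auto
    have JU: "J \<subseteq> U" using J(1) H(1) by auto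
    define y where "y = (\<lambda>e. (1 / m) * (\<Sum>j\<in>J. v j e))"
    define z where "z k = (\<lambda>e. v k e - y e)" for k
    have z_dot_on: "dot_on I (z k) (z l) = dot_on I (v k) (v l) - dot_on I (v k) y - dot_on I (v l) y + dot_on I y y" for k l
      unfolding z_def dot_on_diff_left dot_on_diff_right using dot_on_commute[of I y "v l"] by simp
    have y_dot_on: "dot_on I u y = (\<Sum>j\<in>J. dot_on I u (v j)) / m" for u
      by (simp only: y_def dot_on_scale_right dot_on_sum_right) simp
    have y_self: "dot_on I y y = (\<Sum>i\<in>J. \<Sum>j\<in>J. dot_on I (v i) (v j)) / m\<^sup>2"
    proof -
      have "dot_on I y y = (\<Sum>j\<in>J. dot_on I (v j) y) / m"
        by (subst y_dot_on) (simp only: dot_on_commute[of I y])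
      then show ?thesis
        by (simp add: y_dot_on sum_divide_distrib power2_eq_square)
    qed
    have y_norm: "dot_on I y y \<le> c"
    proof -
      have "(\<Sum>i\<in>J. \<Sum>j\<in>J. dot_on I (v i) (v j)) \<le> (\<Sum>i\<in>J. \<Sum>j\<in>J. c)"
        using dot_on_abs_le[OF norm norm, of _ _] JU by (intro sum_mono) (meson abs_le_D1 subsetD)
      also have "\<dots> = c * m\<^sup>2" by (simp add: J(2) power2_eq_square)
      finally show ?thesis unfolding y_self using m0 by (simp add: divide_le_eq)
    qed
    \<comment> \<open>Only the diagonal terms of the double sum may be far from \<open>a\<close>,
      and together they carry weight \<open>1 / m\<close> in the average.\<close>
    have y_small: "dot_on I y y \<le> a + \<eta> + 2 * c / m"
    proof -
      have "(\<Sum>j\<in>J. dot_on I (v i) (v j)) \<le> m * (a + \<eta>) + 2 * c" if i: "i \<in> J" for i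
      proof -
        have "(\<Sum>j\<in>J. dot_on I (v i) (v j)) = dot_on I (v i) (v i) + (\<Sum>j\<in>J - {i}. dot_on I (v i) (v j))"
          by (rule sum.remove) (use J i in auto)
        also have "\<dots> \<le> c + (\<Sum>j\<in>J - {i}. a + \<eta>)"
          using norm JU i near[of i] J(1) by (intro add_mono sum_mono) auto
        \<comment> \<open>The leftover \<open>- (a + \<eta>)\<close> is at most \<open>c\<close>
          because \<open>- c \<le> a\<close>; this is the second \<open>c\<close> in
          \<open>2 * c\<close>.\<close>
        also have "(\<Sum>j\<in>J - {i}. a + \<eta>) = m * (a + \<eta>) - (a + \<eta>)"
          using i J m0 by (simp add: card_Diff_singleton of_nat_diff left_diff_distrib)
        finally show ?thesis using H(3) \<eta> by simp
      qed
      then have "(\<Sum>i\<in>J. \<Sum>j\<in>J. dot_on I (v i) (v j)) \<le> (\<Sum>i\<in>J. m * (a + \<eta>) + 2 * c)"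
        by (rule sum_mono)
      also have "\<dots> = (a + \<eta> + 2 * c / m) * m\<^sup>2"
        using m0 by (simp add: J(2) power2_eq_square field_simps)
      finally show ?thesis unfolding y_self using m0 by (simp add: divide_le_eq)
    qed
    \<comment> \<open>With \<open>k\<close> outside \<open>J\<close> no diagonal term occurs in the
      average; for this reason the vectors that form the centre are discarded afterwards.\<close>
    have y_cross: "a \<le> dot_on I (v k) y" if "k \<in> H - J" for k
    proof -
      have "(\<Sum>j\<in>J. a) \<le> (\<Sum>j\<in>J. dot_on I (v k) (v j))"
        using that near J(1) by (intro sum_mono) auto
      then show ?thesis unfolding y_dot_on using m0 J(2) by (simp add: le_divide_eq mult.commute)
    qed
    \<comment> \<open>Centring may shorten a vector below \<open>\<epsilon> / 2\<close>, but two
      such vectors would be closer than \<open>\<epsilon>\<close> to each other, so at most one is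
      lost.\<close>
    define G where "G = {k \<in> H - J. \<epsilon>\<^sup>2 / 4 \<le> dot_on I (z k) (z k)}"
    have finH: "finite H" using H(2) by (metis card.infinite add_is_0 one_neq_zero)
    have bad: "k = l" if "k \<in> H - J - G" "l \<in> H - J - G" for k l
    proof (rule ccontr)
      assume "k \<noteq> l"
      then have "\<epsilon>\<^sup>2 \<le> dot_on I (\<lambda>e. v k e - v l e) (\<lambda>e. v k e - v l e)"
        using sep[of k l] that H(1) by auto
      also have "(\<lambda>e. v k e - v l e) = (\<lambda>e. z k e - z l e)"
        by (simp add: z_def)
      also have "dot_on I (\<lambda>e. z k e - z l e) (\<lambda>e. z k e - z l e) \<le> 2 * dot_on I (z k) (z k) + 2 * dot_on I (z l) (z l)"
        by (rule dot_on_parallelogram)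
      also have "\<dots> < \<epsilon>\<^sup>2"
        using that by (auto simp: G_def)
      finally show False by simp
    qed
    have "card (H - J - G) \<le> 1"
      using bad by (metis card_le_Suc0_iff_eq finH finite_Diff One_nat_def)
    moreover have "card (H - J) = m + 1"
      using card_Diff_subset[OF J(3) J(1)] H(2) J(2) by simp
    moreover have "card (H - J - G) = card (H - J) - card G"
      by (rule card_Diff_subset) (use finH in \<open>auto simp: G_def\<close>)
    ultimately have cardG: "m \<le> card G" by linarith
    have finG: "finite G" using finH by (auto simp: G_def)
    have Gne: "G \<noteq> {}" using cardG m0 by auto
    have GU: "G \<subseteq> U" using H(1) by (auto simp: G_def)
    have "L / 2 - 2 * exp (4 * c / 2) \<le> (\<integral>w. h w - dot_on I y w \<partial>gauss I)"
    proof (rule gauss_second_moment[where z = z and \<rho> = "\<epsilon>\<^sup>2 / 4" and \<kappa> = "4 * \<eta>" and \<beta> = \<beta>, OF I finG Gne])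
      show "dot_on I (z k) (z k) \<le> 4 * c" if "k \<in> G" for k
        using dot_on_parallelogram[of I "v k" y] norm[of k] y_norm that GU
        unfolding z_def by auto
      show "\<epsilon>\<^sup>2 / 4 \<le> dot_on I (z k) (z k)" if "k \<in> G" for k
        using that by (simp add: G_def)
      \<comment> \<open>The unknown level \<open>a\<close> cancels:
        \<open>(a + \<eta>) - a - a + (a + \<eta> + 2 * c / m)\<close> is
        \<open>2 * \<eta> + 2 * c / m\<close>, and \<open>c / m \<le> \<eta>\<close>.\<close>
      show "dot_on I (z k) (z l) \<le> 4 * \<eta>" if kl: "k \<in> G" "l \<in> G" "k \<noteq> l" for k l
        using near[of k l] y_cross[of k] y_cross[of l] y_small cm kl
        unfolding z_dot_on G_def by auto
      show "exp (\<beta>\<^sup>2 * (4 * c)) / card G \<le> 1 / 16"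
      proof -
        have "exp (\<beta>\<^sup>2 * (4 * c)) / card G \<le> exp (\<beta>\<^sup>2 * (4 * c)) / m"
          using cardG m0 by (intro divide_left_mono) auto
        also have "\<dots> \<le> 1 / 16" using m m0 by (simp add: field_simps)
        finally show ?thesis .
      qed
      show "exp (\<beta>\<^sup>2 * (4 * \<eta>)) \<le> 17 / 16"
        using \<beta>1 by (simp add: \<eta>_def)
      show "integrable (gauss I) (\<lambda>w. h w - dot_on I y w)"
        by (intro Bochner_Integration.integrable_diff h integrable_gauss_dot_on)
      show "dot_on I (z k) w \<le> h w - dot_on I y w" if "w \<in> space (gauss I)" "k \<in> G" for w k
        using h_ge[OF that(1), of k] that(2) GU unfolding z_def dot_on_diff_left by auto
    qed (use L L0 \<beta>1 in auto)
    also have "(\<integral>w. h w - dot_on I y w \<partial>gauss I) = (\<integral>w. h w \<partial>gauss I)"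
      by (simp add: h integrable_gauss_dot_on integral_gauss_dot_on)
    finally show "\<Psi> \<le> (\<integral>w. h w \<partial>gauss I)"
      using abs_ge_self[of \<Psi>] by (simp add: L_def add_divide_distrib)
  qed
qed

section \<open>Metropolis steps\<close>

definition unif01 :: "real measure" where
  "unif01 = uniform_measure lborel {0..1}"

lemma prob_space_unif01: "prob_space unif01"
  unfolding unif01_def by (rule prob_space_uniform_measure) auto

lemma sets_unif01 [measurable_cong, simp]: "sets unif01 = sets borel"
  by (simp add: unif01_def)

lemma space_unif01 [simp]: "space unif01 = UNIV"
  by (simp add: unif01_def)

lemma emeasure_unif01_accept:
  assumes "0 < a" "0 \<le> b"
  shows "emeasure unif01 {u. u * a \<le> b} = ennreal (min 1 (b / a))"
proof -
  have "{0..1} \<inter> {u. u * a \<le> b} = {0..min 1 (b / a)}"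
    using assms by (auto simp: field_simps)
  moreover have "0 \<le> min 1 (b / a)" using assms by simp
  ultimately show ?thesis
    unfolding unif01_def by (simp add: divide_ennreal_def)
qed

lemma emeasure_unif01_reject:
  assumes "0 < a" "0 \<le> b"
  shows "emeasure unif01 {u. \<not> u * a \<le> b} = ennreal (max 0 (1 - b / a))"
proof -
  interpret prob_space unif01 by (rule prob_space_unif01)
  have "{u. \<not> u * a \<le> b} = space unif01 - {u. u * a \<le> b}" by auto
  then have "emeasure unif01 {u. \<not> u * a \<le> b} = emeasure unif01 (space unif01) - emeasure unif01 {u. u * a \<le> b}"
    by (simp only:) (intro emeasure_compl, auto simp: emeasure_unif01_accept[OF assms])
  also have "\<dots> = ennreal (1 - min 1 (b / a))"
    using assms by (simp only: emeasure_unif01_accept[OF assms] emeasure_space_1 ennreal_1[symmetric])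
      (intro ennreal_minus, auto)
  also have "1 - min 1 (b / a) = max 0 (1 - b / a)" by auto
  finally show ?thesis .
qed

lemma nn_integral_std_gauss_uminus:
  assumes [measurable]: "g \<in> borel_measurable borel"
  shows "(\<integral>\<^sup>+w. g (- w) \<partial>std_gauss) = (\<integral>\<^sup>+w. g w \<partial>std_gauss)"
proof -
  have "(\<integral>\<^sup>+w. g w \<partial>std_gauss) = (\<integral>\<^sup>+w. ennreal (std_normal_density w) * g w \<partial>lborel)"
    unfolding std_gauss_def by (rule nn_integral_density) auto
  also have "\<dots> = (\<integral>\<^sup>+w. ennreal (std_normal_density (- w)) * g (- w) \<partial>lborel)"
    by (subst nn_integral_real_affine[where c = "-1" and t = 0]) auto
  also have "\<dots> = (\<integral>\<^sup>+w. ennreal (std_normal_density w) * g (- w) \<partial>lborel)"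
    by (simp add: normal_density_def)
  also have "\<dots> = (\<integral>\<^sup>+w. g (- w) \<partial>std_gauss)"
    unfolding std_gauss_def by (rule nn_integral_density[symmetric]) auto
  finally show ?thesis by simp
qed

lemma indep_vars_PiM_coordinates:
  assumes "I \<noteq> {}" and M: "\<And>i. i \<in> I \<Longrightarrow> prob_space (M i)"
  shows "prob_space.indep_vars (PiM I M) M (\<lambda>i \<omega>. \<omega> i) I"
proof -
  interpret prob_space "PiM I M" by (intro prob_space_PiM M)
  have "distr (PiM I M) (PiM I M) (\<lambda>\<omega>. restrict \<omega> I) = PiM I M"
    by (subst distr_cong[OF refl refl, of _ _ "\<lambda>\<omega>. \<omega>"]) (auto simp: space_PiM)
  also have "\<dots> = (\<Pi>\<^sub>M i\<in>I. distr (PiM I M) (M i) (\<lambda>\<omega>. \<omega> i))"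
    by (intro PiM_cong refl distr_PiM_component[symmetric] M)
  finally show ?thesis
    by (subst indep_vars_iff_distr_eq_PiM'[OF assms(1)]) auto
qed

text \<open>The rejection bound appears with exponent \<open>p = 1\<close> because a rejected
  proposal leaves the coupling at distance \<open>s\<close> times the modulus of \<open>w\<close>
  from the proposed value.\<close>

locale metropolis =
  fixes f :: "real \<Rightarrow> real" and s C :: real
  assumes f_measurable [measurable]: "f \<in> borel_measurable borel"
    and f_nonneg: "\<And>x. 0 \<le> f x"
    and prob_f: "prob_space (density lborel (\<lambda>x. ennreal (f x)))"
    and integrable_f: "integrable (density lborel (\<lambda>x. ennreal (f x))) (\<lambda>x. x)"
    and s_nonneg: "0 \<le> s"
    and rejection: "(\<integral>z. \<bar>snd z\<bar> powr 1 * max 0 (1 - f (fst z + s * snd z) / f (fst z))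
          \<partial>(density lborel (\<lambda>x. ennreal (f x)) \<Otimes>\<^sub>M
             density lborel (\<lambda>x. ennreal (std_normal_density x)))) \<le> C * s"
begin

definition law :: "real measure" where
  "law = density lborel (\<lambda>x. ennreal (f x))"

text \<open>The Metropolis rule with acceptance ratio \<open>f (x + s * w) / f x\<close>, written
  without division; where \<open>f x = 0\<close> every proposal is accepted.\<close>

definition accepted :: "real \<Rightarrow> real \<Rightarrow> real \<Rightarrow> bool" where
  "accepted x w u \<longleftrightarrow> u * f x \<le> f (x + s * w)"

definition step :: "real \<Rightarrow> real \<Rightarrow> real \<Rightarrow> real" where
  "step x w u = (if accepted x w u then x + s * w else x)"

lemma sets_law [measurable_cong, simp]: "sets law = sets borel"
  by (simp add: law_def)

lemma space_law [simp]: "space law = UNIV"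
  by (simp add: law_def)

lemma prob_space_law: "prob_space law"
  using prob_f by (simp add: law_def)

lemma accepted_measurable [measurable (raw)]:
  assumes [measurable]: "x \<in> borel_measurable M" "w \<in> borel_measurable M" "u \<in> borel_measurable M"
  shows "Measurable.pred M (\<lambda>t. accepted (x t) (w t) (u t))"
  unfolding accepted_def by measurable

lemma step_measurable [measurable (raw)]:
  assumes [measurable]: "x \<in> borel_measurable M" "w \<in> borel_measurable M" "u \<in> borel_measurable M"
  shows "(\<lambda>t. step (x t) (w t) (u t)) \<in> borel_measurable M"
  unfolding step_def by measurable

text \<open>The factor \<open>f x\<close> turns the acceptance probability into
  \<open>min (f x) (f (x + s * w))\<close>, the symmetric quantity behind detailed balance. Where
  \<open>f x = 0\<close> both sides vanish.\<close>

lemma nn_integral_step_indicator: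
  assumes [measurable]: "A \<in> sets borel"
  shows "ennreal (f x) * (\<integral>\<^sup>+u. indicator A (step x w u) \<partial>unif01) =
    ennreal (min (f x) (f (x + s * w))) * indicator A (x + s * w)
    + ennreal (f x - min (f x) (f (x + s * w))) * indicator A x"
proof (cases "f x = 0")
  case True
  then show ?thesis using f_nonneg[of "x + s * w"] by simp
next
  case False
  then have fx: "0 < f x" using f_nonneg[of x] by simp
  note fy = f_nonneg[of "x + s * w"]
  have [measurable]: "{u. u * f x \<le> f (x + s * w)} \<in> sets unif01" "{u. \<not> u * f x \<le> f (x + s * w)} \<in> sets unif01"
    by measurable
  have "(\<integral>\<^sup>+u. indicator A (step x w u) \<partial>unif01) =
    (\<integral>\<^sup>+u. indicator A (x + s * w) * indicator {u. u * f x \<le> f (x + s * w)} u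
       + indicator A x * indicator {u. \<not> u * f x \<le> f (x + s * w)} u \<partial>unif01)"
    by (intro nn_integral_cong) (auto simp: step_def accepted_def indicator_def)
  also have "\<dots> = indicator A (x + s * w) * ennreal (min 1 (f (x + s * w) / f x))
      + indicator A x * ennreal (max 0 (1 - f (x + s * w) / f x))"
    by (subst nn_integral_add)
      (auto simp: nn_integral_cmult_indicator emeasure_unif01_accept[OF fx fy] emeasure_unif01_reject[OF fx fy])
  finally have "ennreal (f x) * (\<integral>\<^sup>+u. indicator A (step x w u) \<partial>unif01) =
     (ennreal (f x) * ennreal (min 1 (f (x + s * w) / f x))) * indicator A (x + s * w)
      + (ennreal (f x) * ennreal (max 0 (1 - f (x + s * w) / f x))) * indicator A x"
    by (simp add: distrib_left mult_ac)
  moreover have "ennreal (f x) * ennreal (min 1 (f (x + s * w) / f x)) = ennreal (min (f x) (f (x + s * w)))"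
    using fx fy by (subst ennreal_mult[symmetric]) (auto simp: min_def field_simps)
  moreover have "ennreal (f x) * ennreal (max 0 (1 - f (x + s * w) / f x))
    = ennreal (f x - min (f x) (f (x + s * w)))"
    using fx fy by (subst ennreal_mult[symmetric]) (auto simp: min_def max_def field_simps)
  ultimately show ?thesis by simp
qed

lemma nn_integral_law:
  assumes [measurable]: "g \<in> borel_measurable borel"
  shows "(\<integral>\<^sup>+x. g x \<partial>law) = (\<integral>\<^sup>+x. ennreal (f x) * g x \<partial>lborel)"
  unfolding law_def by (rule nn_integral_density) auto

text \<open>Detailed balance: the mass moved from \<open>x\<close> to \<open>y = x + s w\<close> has the density
  \<open>min (f x) (f y)\<close>, which is symmetric under \<open>(x, w) \<mapsto> (y, - w)\<close>.\<close>

lemma step_invariant: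
  assumes A [measurable]: "A \<in> sets borel"
  shows "(\<integral>\<^sup>+x. \<integral>\<^sup>+w. \<integral>\<^sup>+u. indicator A (step x w u) \<partial>unif01 \<partial>std_gauss \<partial>law) = emeasure law A"
proof -
  interpret N: prob_space std_gauss by (rule prob_space_std_gauss)
  interpret U: prob_space unif01 by (rule prob_space_unif01)
  interpret LN: pair_sigma_finite lborel std_gauss
    by (intro pair_sigma_finite.intro sigma_finite_lborel prob_space_imp_sigma_finite prob_space_std_gauss)
  define \<mu> where "\<mu> x w = ennreal (min (f x) (f (x + s * w)))" for x w
  define \<nu> where "\<nu> x w = ennreal (f x - min (f x) (f (x + s * w)))" for x w
  have [measurable]: "(\<lambda>(x, w). \<mu> x w) \<in> borel_measurable (borel \<Otimes>\<^sub>M borel)"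
    "(\<lambda>(x, w). \<nu> x w) \<in> borel_measurable (borel \<Otimes>\<^sub>M borel)"
    unfolding \<mu>_def \<nu>_def by measurable
  have [measurable]: "(\<lambda>x. \<integral>\<^sup>+w. \<integral>\<^sup>+u. indicator A (step x w u) \<partial>unif01 \<partial>std_gauss) \<in> borel_measurable borel"
    by measurable
  have [measurable]: "(\<lambda>w. \<integral>\<^sup>+u. indicator A (step x w u) \<partial>unif01) \<in> borel_measurable borel" for x
    by measurable
  have "(\<integral>\<^sup>+x. \<integral>\<^sup>+w. \<integral>\<^sup>+u. indicator A (step x w u) \<partial>unif01 \<partial>std_gauss \<partial>law)
    = (\<integral>\<^sup>+x. \<integral>\<^sup>+w. ennreal (f x) * (\<integral>\<^sup>+u. indicator A (step x w u) \<partial>unif01) \<partial>std_gauss \<partial>lborel)"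
    by (simp add: nn_integral_law nn_integral_cmult)
  also have "\<dots> = (\<integral>\<^sup>+x. \<integral>\<^sup>+w. \<mu> x w * indicator A (x + s * w) + \<nu> x w * indicator A x \<partial>std_gauss \<partial>lborel)"
    unfolding nn_integral_step_indicator[OF A] \<mu>_def \<nu>_def ..
  also have "\<dots> = (\<integral>\<^sup>+x. \<integral>\<^sup>+w. \<mu> x w * indicator A (x + s * w) \<partial>std_gauss \<partial>lborel)
     + (\<integral>\<^sup>+x. \<integral>\<^sup>+w. \<nu> x w * indicator A x \<partial>std_gauss \<partial>lborel)"
    by (simp add: nn_integral_add)
  also have "(\<integral>\<^sup>+x. \<integral>\<^sup>+w. \<mu> x w * indicator A (x + s * w) \<partial>std_gauss \<partial>lborel)
    = (\<integral>\<^sup>+w. \<integral>\<^sup>+x. \<mu> x w * indicator A (x + s * w) \<partial>lborel \<partial>std_gauss)"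
    by (rule LN.Fubini'[symmetric]) measurable
  \<comment> \<open>For fixed \<open>w\<close>, translating \<open>x\<close> by
    \<open>- s * w\<close> exchanges the two arguments of the minimum, so \<open>\<mu>\<close>
    reappears with \<open>- w\<close>; the symmetry of the Gaussian then removes the sign.\<close>
  also have "\<dots> = (\<integral>\<^sup>+w. \<integral>\<^sup>+x. \<mu> x (- w) * indicator A x \<partial>lborel \<partial>std_gauss)"
  proof (rule nn_integral_cong)
    fix w
    show "(\<integral>\<^sup>+x. \<mu> x w * indicator A (x + s * w) \<partial>lborel) = (\<integral>\<^sup>+x. \<mu> x (- w) * indicator A x \<partial>lborel)"
      by (subst nn_integral_real_affine[where c = 1 and t = "- s * w"]) (auto simp: \<mu>_def min.commute algebra_simps)
  qed
  also have "\<dots> = (\<integral>\<^sup>+w. \<integral>\<^sup>+x. \<mu> x w * indicator A x \<partial>lborel \<partial>std_gauss)"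
    by (rule nn_integral_std_gauss_uminus[where g = "\<lambda>w. \<integral>\<^sup>+x. \<mu> x w * indicator A x \<partial>lborel"]) measurable
  also have "\<dots> = (\<integral>\<^sup>+x. \<integral>\<^sup>+w. \<mu> x w * indicator A x \<partial>std_gauss \<partial>lborel)"
    by (rule LN.Fubini') measurable
  also have "\<dots> + (\<integral>\<^sup>+x. \<integral>\<^sup>+w. \<nu> x w * indicator A x \<partial>std_gauss \<partial>lborel)
    = (\<integral>\<^sup>+x. \<integral>\<^sup>+w. \<mu> x w * indicator A x + \<nu> x w * indicator A x \<partial>std_gauss \<partial>lborel)"
    by (simp add: nn_integral_add)
  also have "\<dots> = (\<integral>\<^sup>+x. \<integral>\<^sup>+w. ennreal (f x) * indicator A x \<partial>std_gauss \<partial>lborel)"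
  proof -
    have "\<mu> x w + \<nu> x w = ennreal (f x)" for x w
      unfolding \<mu>_def \<nu>_def using f_nonneg by (subst ennreal_plus[symmetric]) auto
    then show ?thesis by (simp add: distrib_right[symmetric])
  qed
  also have "\<dots> = (\<integral>\<^sup>+x. ennreal (f x) * indicator A x \<partial>lborel)"
    by (simp add: N.emeasure_space_1[simplified])
  also have "\<dots> = emeasure law A"
    unfolding law_def by (rule emeasure_density[symmetric]) auto
  finally show ?thesis .
qed

text \<open>Given \<open>x\<close> with \<open>f x > 0\<close> and \<open>w\<close>, a proposal is
  rejected with probability \<open>max 0 (1 - f (x + s * w) / f x)\<close>, so integrating out
  \<open>u\<close> leaves the integrand of the rejection assumption.\<close>

lemma rejected_le:
  "(\<integral>\<^sup>+x. \<integral>\<^sup>+w. \<integral>\<^sup>+u. ennreal (if accepted x w u then 0 else \<bar>w\<bar>) \<partial>unif01 \<partial>std_gauss \<partial>law) \<le> ennreal (C * s)"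
proof -
  interpret N: prob_space std_gauss by (rule prob_space_std_gauss)
  interpret P: prob_space law by (rule prob_space_law)
  interpret PN: pair_sigma_finite law std_gauss
    by (intro pair_sigma_finite.intro prob_space_imp_sigma_finite prob_space_law prob_space_imp_sigma_finite prob_space_std_gauss)
  define r where "r z = \<bar>snd z\<bar> * max 0 (1 - f (fst z + s * snd z) / f (fst z))" for z
  have [measurable]: "r \<in> borel_measurable (borel \<Otimes>\<^sub>M borel)"
    unfolding r_def by measurable
  have r0: "0 \<le> r z" for z by (simp add: r_def)
  have int_abs: "integrable (law \<Otimes>\<^sub>M std_gauss) (\<lambda>z. \<bar>snd z\<bar>)"
  proof -
    have "integrable std_gauss (\<lambda>w. \<bar>w\<bar>)"
      using integrable_std_gauss_id by (rule integrable_abs)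
    then have fin: "(\<integral>\<^sup>+w. ennreal \<bar>w\<bar> \<partial>std_gauss) < \<infinity>"
      by (simp add: integrable_iff_bounded)
    have "(\<integral>\<^sup>+z. ennreal \<bar>snd z\<bar> \<partial>(law \<Otimes>\<^sub>M std_gauss)) = (\<integral>\<^sup>+x. \<integral>\<^sup>+w. ennreal \<bar>w\<bar> \<partial>std_gauss \<partial>law)"
      by (subst gauss.M.nn_integral_fst[symmetric]) auto
    also have "\<dots> < \<infinity>"
      using fin by (simp add: P.emeasure_space_1[simplified])
    finally show ?thesis by (intro integrableI_bounded) auto
  qed
  \<comment> \<open>A Bochner integral is 0 by default for a non-integrable function, so the assumed
    bound says something about the nonnegative integral only once integrability is known.\<close>
  have int_r: "integrable (law \<Otimes>\<^sub>M std_gauss) r"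
  proof (rule Bochner_Integration.integrable_bound[OF int_abs])
    have "max 0 (1 - f (fst z + s * snd z) / f (fst z)) \<le> 1" for z
      using f_nonneg by simp
    then have "\<bar>r z\<bar> \<le> \<bar>snd z\<bar> * 1" for z
      unfolding r_def abs_mult by (intro mult_mono) auto
    then show "AE z in law \<Otimes>\<^sub>M std_gauss. norm (r z) \<le> norm \<bar>snd z\<bar>" by auto
  qed measurable
  have "(\<integral>\<^sup>+x. \<integral>\<^sup>+w. \<integral>\<^sup>+u. ennreal (if accepted x w u then 0 else \<bar>w\<bar>) \<partial>unif01 \<partial>std_gauss \<partial>law)
     \<le> (\<integral>\<^sup>+x. \<integral>\<^sup>+w. ennreal (r (x, w)) \<partial>std_gauss \<partial>law)"
  proof (rule nn_integral_mono_AE)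
    have "AE x in law. f x > 0"
      unfolding law_def by (subst AE_density) auto
    then show "AE x in law. (\<integral>\<^sup>+w. \<integral>\<^sup>+u. ennreal (if accepted x w u then 0 else \<bar>w\<bar>) \<partial>unif01 \<partial>std_gauss)
      \<le> (\<integral>\<^sup>+w. ennreal (r (x, w)) \<partial>std_gauss)"
    proof eventually_elim
      fix x assume fx: "f x > 0"
      have "(\<integral>\<^sup>+u. ennreal (if accepted x w u then 0 else \<bar>w\<bar>) \<partial>unif01) = ennreal (r (x, w))" for w
      proof -
        have [measurable]: "{u. \<not> u * f x \<le> f (x + s * w)} \<in> sets unif01" by measurable
        have "(\<integral>\<^sup>+u. ennreal (if accepted x w u then 0 else \<bar>w\<bar>) \<partial>unif01)
          = (\<integral>\<^sup>+u. ennreal \<bar>w\<bar> * indicator {u. \<not> u * f x \<le> f (x + s * w)} u \<partial>unif01)"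
          by (intro nn_integral_cong) (auto simp: accepted_def indicator_def)
        also have "\<dots> = ennreal \<bar>w\<bar> * ennreal (max 0 (1 - f (x + s * w) / f x))"
          by (simp add: nn_integral_cmult_indicator emeasure_unif01_reject[OF fx f_nonneg])
        also have "\<dots> = ennreal (r (x, w))"
          by (simp add: r_def ennreal_mult)
        finally show ?thesis .
      qed
      then show "(\<integral>\<^sup>+w. \<integral>\<^sup>+u. ennreal (if accepted x w u then 0 else \<bar>w\<bar>) \<partial>unif01 \<partial>std_gauss)
        \<le> (\<integral>\<^sup>+w. ennreal (r (x, w)) \<partial>std_gauss)" by simp
    qed
  qed
  also have "\<dots> = (\<integral>\<^sup>+z. ennreal (r z) \<partial>(law \<Otimes>\<^sub>M std_gauss))"
    by (rule gauss.M.nn_integral_fst) measurable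
  also have "\<dots> = ennreal (\<integral>z. r z \<partial>(law \<Otimes>\<^sub>M std_gauss))"
    by (rule nn_integral_eq_integral[OF int_r]) (simp add: r0)
  also have "\<dots> \<le> ennreal (C * s)"
    using rejection unfolding law_def std_gauss_def r_def by (intro ennreal_leI) simp
  finally show ?thesis .
qed

text \<open>Indexing the three laws by a number lets one product measure carry all the randomness;
  the triple at an edge and the pair of old disorder and increments are both projections of
  it.\<close>

definition coord_law :: "nat \<Rightarrow> real measure" where
  "coord_law b = (if b = 0 then law else if b = 1 then std_gauss else unif01)"

text \<open>The coordinates \<open>(e, 0)\<close>, \<open>(e, 1)\<close>, \<open>(e, 2)\<close> are the old value, the Gaussian increment and
  the acceptance variable at \<open>e\<close>.\<close>

definition noise :: "'e set \<Rightarrow> ('e \<times> nat \<Rightarrow> real) measure" where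
  "noise E = (\<Pi>\<^sub>M j\<in>E \<times> {0, 1, 2}. coord_law (snd j))"

lemma coord_law_eqs: "coord_law 0 = law" "coord_law 1 = std_gauss" "coord_law (Suc 0) = std_gauss" "coord_law 2 = unif01"
  by (simp_all add: coord_law_def)

lemma sets_coord_law [measurable_cong, simp]: "sets (coord_law b) = sets borel"
  by (simp add: coord_law_def)

lemma prob_space_coord_law: "prob_space (coord_law b)"
  by (simp add: coord_law_def prob_space_law prob_space_std_gauss prob_space_unif01)

lemma prob_space_noise: "prob_space (noise E)"
  unfolding noise_def by (intro prob_space_PiM prob_space_coord_law)

lemma sets_noise [measurable_cong]: "sets (noise E) = sets (\<Pi>\<^sub>M j\<in>E \<times> {0, 1, 2}. borel)"
  unfolding noise_def by (intro sets_PiM_cong) auto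

lemma noise_coordinate:
  "e \<in> E \<Longrightarrow> b \<in> {0, 1, 2} \<Longrightarrow> (\<lambda>\<omega>. \<omega> (e, b)) \<in> borel_measurable (noise E)"
  unfolding measurable_cong_sets[OF sets_noise refl]
  by (rule measurable_component_singleton) auto

lemma nn_integral_noise_block:
  assumes e: "e \<in> E" and \<phi> [measurable]: "\<phi> \<in> borel_measurable (borel \<Otimes>\<^sub>M borel \<Otimes>\<^sub>M borel)"
  shows "(\<integral>\<^sup>+\<omega>. \<phi> (\<omega> (e, 0), \<omega> (e, 1), \<omega> (e, 2)) \<partial>noise E) =
    (\<integral>\<^sup>+x. \<integral>\<^sup>+w. \<integral>\<^sup>+u. \<phi> (x, w, u) \<partial>unif01 \<partial>std_gauss \<partial>law)"
proof -
  interpret product_sigma_finite coord_law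
    by (simp add: product_sigma_finite_def prob_space_coord_law prob_space_imp_sigma_finite)
  let ?B = "{0, 1, 2} :: nat set"
  have D: "distr (noise E) (\<Pi>\<^sub>M b\<in>?B. coord_law b) (\<lambda>\<omega>. \<lambda>b\<in>?B. \<omega> (e, b)) = (\<Pi>\<^sub>M b\<in>?B. coord_law b)"
  proof -
    have "distr (\<Pi>\<^sub>M j\<in>E \<times> ?B. coord_law (snd j)) (\<Pi>\<^sub>M b\<in>?B. coord_law (snd (e, b))) (\<lambda>\<omega>. \<lambda>b\<in>?B. \<omega> (e, b))
      = (\<Pi>\<^sub>M b\<in>?B. coord_law (snd (e, b)))"
      by (rule distr_PiM_reindex) (use e in \<open>simp_all add: prob_space_coord_law inj_on_def\<close>)
    then show ?thesis by (simp only: noise_def snd_conv)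
  qed
  have m: "(\<lambda>\<omega>. \<lambda>b\<in>?B. \<omega> (e, b)) \<in> noise E \<rightarrow>\<^sub>M (\<Pi>\<^sub>M b\<in>?B. coord_law b)"
    unfolding noise_def using e by (intro measurable_restrict) auto
  have c: "(\<lambda>y. y b) \<in> borel_measurable (PiM A coord_law)" if "b \<in> A" for A b
    using measurable_component_singleton[OF that, of coord_law]
    unfolding measurable_cong_sets[OF refl sets_coord_law] .
  have \<phi>B: "(\<lambda>y. \<phi> (y 0, y 1, y 2)) \<in> borel_measurable (\<Pi>\<^sub>M b\<in>?B. coord_law b)"
    by (rule measurable_compose[OF _ \<phi>]) (intro measurable_Pair c; simp)
  have "(\<integral>\<^sup>+\<omega>. \<phi> (\<omega> (e, 0), \<omega> (e, 1), \<omega> (e, 2)) \<partial>noise E) = (\<integral>\<^sup>+y. \<phi> (y 0, y 1, y 2) \<partial>(\<Pi>\<^sub>M b\<in>?B. coord_law b))"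
    using nn_integral_distr[OF m, unfolded measurable_distr_eq1, OF \<phi>B]
    by (simp only: D restrict_apply insert_iff simp_thms if_True)
  also have "\<dots> = (\<integral>\<^sup>+x. \<integral>\<^sup>+y. \<phi> (x, y 1, y 2) \<partial>(\<Pi>\<^sub>M b\<in>{1, 2}. coord_law b) \<partial>law)"
    using product_nn_integral_insert_rev[OF _ _ \<phi>B] by (simp add: coord_law_eqs)
  also have "\<dots> = (\<integral>\<^sup>+x. \<integral>\<^sup>+w. \<integral>\<^sup>+y. \<phi> (x, w, y 2) \<partial>(\<Pi>\<^sub>M b\<in>{2}. coord_law b) \<partial>std_gauss \<partial>law)"
  proof (rule nn_integral_cong)
    fix x
    have "(\<lambda>y. \<phi> (x, y 1, y 2)) \<in> borel_measurable (\<Pi>\<^sub>M b\<in>insert 1 {2}. coord_law b)"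
      by (rule measurable_compose[OF _ \<phi>]) (intro measurable_Pair c measurable_const; simp)
    from product_nn_integral_insert_rev[OF _ _ this]
    show "(\<integral>\<^sup>+y. \<phi> (x, y 1, y 2) \<partial>(\<Pi>\<^sub>M b\<in>{1, 2}. coord_law b))
      = (\<integral>\<^sup>+w. \<integral>\<^sup>+y. \<phi> (x, w, y 2) \<partial>(\<Pi>\<^sub>M b\<in>{2}. coord_law b) \<partial>std_gauss)"
      by (simp add: coord_law_eqs)
  qed
  also have "\<dots> = (\<integral>\<^sup>+x. \<integral>\<^sup>+w. \<integral>\<^sup>+u. \<phi> (x, w, u) \<partial>unif01 \<partial>std_gauss \<partial>law)"
  proof (intro nn_integral_cong)
    fix x w
    have "(\<lambda>u. \<phi> (x, w, u)) \<in> borel_measurable (coord_law 2)"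
      by (simp add: measurable_cong_sets[OF sets_coord_law refl])
    from product_nn_integral_singleton[OF this]
    show "(\<integral>\<^sup>+y. \<phi> (x, w, y 2) \<partial>(\<Pi>\<^sub>M b\<in>{2}. coord_law b)) = (\<integral>\<^sup>+u. \<phi> (x, w, u) \<partial>unif01)"
      by (simp only: coord_law_eqs)
  qed
  finally show ?thesis .
qed

lemma indep_vars_noise:
  assumes "E \<noteq> {}"
  shows "prob_space.indep_vars (noise E) (\<lambda>j. coord_law (snd j)) (\<lambda>j \<omega>. \<omega> j) (E \<times> {0, 1, 2})"
  unfolding noise_def using assms by (intro indep_vars_PiM_coordinates prob_space_coord_law) auto

definition moved :: "'e set \<Rightarrow> ('e \<times> nat \<Rightarrow> real) \<Rightarrow> 'e \<Rightarrow> real" where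
  "moved E \<omega> = (\<lambda>e\<in>E. step (\<omega> (e, 0)) (\<omega> (e, 1)) (\<omega> (e, 2)))"

lemma moved_measurable [measurable]: "moved E \<in> noise E \<rightarrow>\<^sub>M (\<Pi>\<^sub>M e\<in>E. borel)"
  unfolding moved_def by (intro measurable_restrict step_measurable noise_coordinate) auto

text \<open>Different edges use disjoint blocks of coordinates, so their moves are independent, and
  each single move preserves \<open>law\<close> by \<open>step_invariant\<close>.\<close>

lemma distr_moved:
  assumes "E \<noteq> {}"
  shows "distr (noise E) (\<Pi>\<^sub>M e\<in>E. borel) (moved E) = (\<Pi>\<^sub>M e\<in>E. law)"
proof -
  interpret prob_space "noise E" by (rule prob_space_noise)
  let ?S = "\<lambda>e \<omega>. step (\<omega> (e, 0)) (\<omega> (e, 1)) (\<omega> (e, 2))"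
  let ?K = "\<lambda>e. {e} \<times> {0, 1, 2 :: nat}"
  have "indep_vars (\<lambda>e. \<Pi>\<^sub>M j\<in>?K e. coord_law (snd j)) (\<lambda>e \<omega>. restrict (\<lambda>j. \<omega> j) (?K e)) E"
    by (rule indep_vars_restrict[OF indep_vars_noise[OF assms]]) (auto simp: disjoint_family_on_def)
  then have "indep_vars (\<lambda>_. borel) (\<lambda>e \<omega>. ?S e (restrict (\<lambda>j. \<omega> j) (?K e))) E"
  proof (rule indep_vars_compose2)
    fix e
    have "(\<lambda>\<omega>. \<omega> (e, b)) \<in> borel_measurable (\<Pi>\<^sub>M j\<in>?K e. coord_law (snd j))" if "b \<in> {0, 1, 2}" for b
      using measurable_component_singleton[of "(e, b)" "?K e" "\<lambda>j. coord_law (snd j)"] that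
      by (auto simp: measurable_cong_sets[OF refl sets_coord_law])
    then show "?S e \<in> borel_measurable (\<Pi>\<^sub>M j\<in>?K e. coord_law (snd j))"
      by (intro step_measurable) auto
  qed
  then have ind: "indep_vars (\<lambda>_. borel) ?S E" by simp
  have rv: "?S e \<in> borel_measurable (noise E)" if "e \<in> E" for e
    using that by (intro step_measurable noise_coordinate) auto
  have "distr (noise E) (\<Pi>\<^sub>M e\<in>E. borel) (moved E) = (\<Pi>\<^sub>M e\<in>E. distr (noise E) borel (?S e))"
    using indep_vars_iff_distr_eq_PiM'[OF assms, where M' = "\<lambda>_. borel" and X = ?S] rv ind
    by (simp add: moved_def[abs_def])
  also have "\<dots> = (\<Pi>\<^sub>M e\<in>E. law)"
  proof (intro PiM_cong refl measure_eqI)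
    fix e A assume e: "e \<in> E" and "A \<in> sets (distr (noise E) borel (?S e))"
    then have [measurable]: "A \<in> sets borel" by simp
    have "emeasure (distr (noise E) borel (?S e)) A = (\<integral>\<^sup>+\<omega>. indicator A (?S e \<omega>) \<partial>noise E)"
      using nn_integral_distr[OF rv[OF e], of "indicator A"] by simp
    also have "\<dots> = (\<integral>\<^sup>+x. \<integral>\<^sup>+w. \<integral>\<^sup>+u. indicator A (step x w u) \<partial>unif01 \<partial>std_gauss \<partial>law)"
      using nn_integral_noise_block[OF e, of "\<lambda>(x, w, u). indicator A (step x w u)"] by simp
    also have "\<dots> = emeasure law A" by (rule step_invariant) simp
    finally show "emeasure (distr (noise E) borel (?S e)) A = emeasure law A" .
  qed simp
  finally show ?thesis .
qed

text \<open>The old values and the increments sit on disjoint coordinates and are therefore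
  independent. This permits averaging over the Gaussian shift with the disorder held fixed.\<close>

lemma distr_noise_pair:
  fixes E :: "'e set"
  assumes "E \<noteq> {}"
  shows "distr (noise E) ((\<Pi>\<^sub>M e\<in>E. law) \<Otimes>\<^sub>M gauss E) (\<lambda>\<omega>. (\<lambda>e\<in>E. \<omega> (e, 0), \<lambda>e\<in>E. \<omega> (e, 1)))
    = (\<Pi>\<^sub>M e\<in>E. law) \<Otimes>\<^sub>M gauss E"
proof -
  interpret prob_space "noise E" by (rule prob_space_noise)
  let ?M = "\<lambda>j. coord_law (snd j)"
  have "indep_var (PiM (E \<times> {0}) ?M) (\<lambda>\<omega>. restrict (\<lambda>j. \<omega> j) (E \<times> {0}))
      (PiM (E \<times> {1}) ?M) (\<lambda>\<omega>. restrict (\<lambda>j. \<omega> j) (E \<times> {1}))"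
    by (rule indep_var_restrict[OF indep_vars_noise[OF assms]]) auto
  then have "indep_var (\<Pi>\<^sub>M e\<in>E. law) ((\<lambda>\<omega>. \<lambda>e\<in>E. \<omega> (e, 0)) \<circ> (\<lambda>\<omega>. restrict (\<lambda>j. \<omega> j) (E \<times> {0})))
      (gauss E) ((\<lambda>\<omega>. \<lambda>e\<in>E. \<omega> (e, 1)) \<circ> (\<lambda>\<omega>. restrict (\<lambda>j. \<omega> j) (E \<times> {1})))"
  proof (rule indep_var_compose)
    have "(\<lambda>\<omega>. \<omega> (e, 0)) \<in> PiM (E \<times> {0}) ?M \<rightarrow>\<^sub>M law" if "e \<in> E" for e
      using measurable_component_singleton[of "(e, 0)" "E \<times> {0}" ?M] that by (simp add: coord_law_def)
    then show "(\<lambda>\<omega>. \<lambda>e\<in>E. \<omega> (e, 0)) \<in> PiM (E \<times> {0}) ?M \<rightarrow>\<^sub>M (\<Pi>\<^sub>M e\<in>E. law)"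
      by (intro measurable_restrict)
    have "(\<lambda>\<omega>. \<omega> (e, 1)) \<in> PiM (E \<times> {1}) ?M \<rightarrow>\<^sub>M std_gauss" if "e \<in> E" for e
      using measurable_component_singleton[of "(e, 1)" "E \<times> {1}" ?M] that by (simp add: coord_law_def)
    then show "(\<lambda>\<omega>. \<lambda>e\<in>E. \<omega> (e, 1)) \<in> PiM (E \<times> {1}) ?M \<rightarrow>\<^sub>M gauss E"
      unfolding gauss_def by (intro measurable_restrict)
  qed
  moreover have "(\<lambda>\<omega> :: 'e \<times> nat \<Rightarrow> real. \<lambda>e\<in>E. \<omega> (e, b)) \<circ> (\<lambda>\<omega>. restrict (\<lambda>j. \<omega> j) (E \<times> {b})) = (\<lambda>\<omega>. \<lambda>e\<in>E. \<omega> (e, b))" for b :: nat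
    by (auto simp: fun_eq_iff)
  ultimately have "indep_var (\<Pi>\<^sub>M e\<in>E. law) (\<lambda>\<omega>. \<lambda>e\<in>E. \<omega> (e, 0)) (gauss E) (\<lambda>\<omega>. \<lambda>e\<in>E. \<omega> (e, 1))"
    by (simp only:)
  moreover have "distr (noise E) (\<Pi>\<^sub>M e\<in>E. law) (\<lambda>\<omega>. \<lambda>e\<in>E. \<omega> (e, 0)) = (\<Pi>\<^sub>M e\<in>E. law)"
  proof -
    have "distr (PiM (E \<times> {0, 1, 2}) ?M) (\<Pi>\<^sub>M e\<in>E. ?M (e, 0)) (\<lambda>\<omega>. \<lambda>e\<in>E. \<omega> (e, 0)) = (\<Pi>\<^sub>M e\<in>E. ?M (e, 0))"
      by (rule distr_PiM_reindex) (auto simp: prob_space_coord_law inj_on_def)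
    then show ?thesis by (simp only: noise_def snd_conv coord_law_eqs)
  qed
  moreover have "distr (noise E) (gauss E) (\<lambda>\<omega>. \<lambda>e\<in>E. \<omega> (e, 1)) = gauss E"
  proof -
    have "distr (PiM (E \<times> {0, 1, 2}) ?M) (\<Pi>\<^sub>M e\<in>E. ?M (e, 1)) (\<lambda>\<omega>. \<lambda>e\<in>E. \<omega> (e, 1)) = (\<Pi>\<^sub>M e\<in>E. ?M (e, 1))"
      by (rule distr_PiM_reindex) (auto simp: prob_space_coord_law inj_on_def)
    then show ?thesis by (simp only: noise_def gauss_def snd_conv coord_law_eqs)
  qed
  ultimately show ?thesis
    by (simp add: indep_var_distribution_eq)
qed

lemma integrable_noise_coordinate:
  assumes "e \<in> E"
  shows "integrable (noise E) (\<lambda>\<omega>. \<omega> (e, 0))" "integrable (noise E) (\<lambda>\<omega>. \<omega> (e, 1))"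
proof -
  have d: "distr (noise E) (coord_law b) (\<lambda>\<omega>. \<omega> (e, b)) = coord_law b" if "b \<in> {0, 1, 2}" for b
    using distr_PiM_component[of "E \<times> {0, 1, 2}" "\<lambda>j. coord_law (snd j)" "(e, b)"] assms that
    by (simp add: noise_def prob_space_coord_law)
  have m: "(\<lambda>\<omega>. \<omega> (e, b)) \<in> noise E \<rightarrow>\<^sub>M coord_law b" if "b \<in> {0, 1, 2}" for b
    unfolding measurable_cong_sets[OF refl sets_coord_law] by (rule noise_coordinate[OF assms that])
  show "integrable (noise E) (\<lambda>\<omega>. \<omega> (e, 0))"
    using integrable_distr[OF m[of 0], of "\<lambda>x. x"] d[of 0] integrable_f
    by (simp add: coord_law_def law_def)
  show "integrable (noise E) (\<lambda>\<omega>. \<omega> (e, 1))"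
    using integrable_distr[OF m[of 1], of "\<lambda>x. x"] d[of 1] integrable_std_gauss_id
    by (simp add: coord_law_def)
qed

lemma Cs_nonneg: "0 \<le> C * s"
  by (rule order_trans[OF Bochner_Integration.integral_nonneg rejection]) simp

lemma expected_rejection:
  assumes e: "e \<in> E"
  defines "r \<equiv> \<lambda>\<omega>. if accepted (\<omega> (e, 0)) (\<omega> (e, 1)) (\<omega> (e, 2)) then 0 else \<bar>\<omega> (e, 1)\<bar>"
  shows "integrable (noise E) r" "(\<integral>\<omega>. r \<omega> \<partial>noise E) \<le> C * s"
proof -
  have m: "r \<in> borel_measurable (noise E)"
  proof -
    have [measurable]: "(\<lambda>\<omega>. \<omega> (e, 0)) \<in> borel_measurable (noise E)"
      "(\<lambda>\<omega>. \<omega> (e, 1)) \<in> borel_measurable (noise E)" "(\<lambda>\<omega>. \<omega> (e, 2)) \<in> borel_measurable (noise E)"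
      using e by (auto intro: noise_coordinate)
    show ?thesis unfolding r_def by measurable
  qed
  show i: "integrable (noise E) r"
    by (rule Bochner_Integration.integrable_bound[OF integrable_noise_coordinate(2)[OF e] m]) (auto simp: r_def)
  have "ennreal (\<integral>\<omega>. r \<omega> \<partial>noise E) = (\<integral>\<^sup>+\<omega>. ennreal (r \<omega>) \<partial>noise E)"
    by (rule nn_integral_eq_integral[symmetric, OF i]) (simp add: r_def)
  also have "\<dots> \<le> ennreal (C * s)"
    using rejected_le nn_integral_noise_block[OF e, of "\<lambda>(x, w, u). ennreal (if accepted x w u then 0 else \<bar>w\<bar>)"]
    by (simp add: r_def del: One_nat_def)
  finally show "(\<integral>\<omega>. r \<omega> \<partial>noise E) \<le> C * s"
    using Cs_nonneg by (simp add: ennreal_le_iff)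
qed

text \<open>The moved and the shifted disorder live on the common space \<open>noise E\<close> and
  differ only where a proposal is rejected. As the moved disorder has the law of the old one, the
  Lipschitz bound gives the comparison in expectation. One factor \<open>s\<close> is the step
  length, the other comes from the rejection bound.\<close>

lemma metropolis_comparison:
  fixes m :: "('e \<Rightarrow> real) \<Rightarrow> real"
  assumes E: "finite E" "E \<noteq> {}"
    and m: "m \<in> borel_measurable (\<Pi>\<^sub>M e\<in>E. borel)"
    and lip: "\<And>x y. x \<in> E \<rightarrow>\<^sub>E UNIV \<Longrightarrow> y \<in> E \<rightarrow>\<^sub>E UNIV \<Longrightarrow> \<bar>m x - m y\<bar> \<le> (\<Sum>e\<in>E. \<bar>x e - y e\<bar>)"
  shows "integrable (\<Pi>\<^sub>M e\<in>E. law) m"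
    and "integrable ((\<Pi>\<^sub>M e\<in>E. law) \<Otimes>\<^sub>M gauss E) (\<lambda>z. m (\<lambda>e\<in>E. fst z e + s * snd z e))"
    and "(\<integral>x. m x \<partial>(\<Pi>\<^sub>M e\<in>E. law)) \<le>
      (\<integral>z. m (\<lambda>e\<in>E. fst z e + s * snd z e) \<partial>((\<Pi>\<^sub>M e\<in>E. law) \<Otimes>\<^sub>M gauss E)) + s * (card E * (C * s))"
proof -
  interpret prob_space "noise E" by (rule prob_space_noise)
  let ?P = "\<Pi>\<^sub>M e\<in>E. law"
  let ?\<pi> = "\<lambda>\<omega>. (\<lambda>e\<in>E. \<omega> (e, 0), \<lambda>e\<in>E. \<omega> (e, 1::nat)) :: ('e \<Rightarrow> real) \<times> ('e \<Rightarrow> real)"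
  define shift where "shift z = (\<lambda>e\<in>E. fst z e + s * snd z e)" for z :: "('e \<Rightarrow> real) \<times> ('e \<Rightarrow> real)"
  define r where "r e \<omega> = (if accepted (\<omega> (e, 0)) (\<omega> (e, 1)) (\<omega> (e, 2)) then 0 else \<bar>\<omega> (e, 1)\<bar>)" for e and \<omega> :: "'e \<times> nat \<Rightarrow> real"
  have sets_P: "sets ?P = sets (\<Pi>\<^sub>M e\<in>E. borel)" by (intro sets_PiM_cong) auto
  have mP: "m \<in> borel_measurable ?P" unfolding measurable_cong_sets[OF sets_P refl] by (rule m)
  have \<pi>: "?\<pi> \<in> noise E \<rightarrow>\<^sub>M ?P \<Otimes>\<^sub>M gauss E"
    unfolding measurable_cong_sets[OF refl sets_pair_measure_cong[OF sets_P sets_gauss]]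
    by (intro measurable_Pair measurable_restrict noise_coordinate) auto
  have shift: "shift \<in> ?P \<Otimes>\<^sub>M gauss E \<rightarrow>\<^sub>M (\<Pi>\<^sub>M e\<in>E. borel)"
    unfolding shift_def measurable_cong_sets[OF sets_pair_measure_cong[OF sets_P sets_gauss] refl]
    by (intro measurable_restrict borel_measurable_add borel_measurable_times borel_measurable_const
        measurable_compose[OF measurable_fst measurable_component_singleton]
        measurable_compose[OF measurable_snd measurable_component_singleton])
  have mshift: "(\<lambda>z. m (shift z)) \<in> borel_measurable (?P \<Otimes>\<^sub>M gauss E)"
    using measurable_compose[OF shift m] .
  have moved_PiE: "moved E \<omega> \<in> E \<rightarrow>\<^sub>E UNIV" for \<omega> by (auto simp: moved_def)
  have shift_PiE: "shift z \<in> E \<rightarrow>\<^sub>E UNIV" for z by (auto simp: shift_def)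
  define z0 where "z0 = (\<lambda>e\<in>E. 0 :: real)"
  have z0: "z0 \<in> E \<rightarrow>\<^sub>E UNIV" by (auto simp: z0_def)
  have grow: "\<bar>m x\<bar> \<le> \<bar>m z0\<bar> + (\<Sum>e\<in>E. \<bar>x e\<bar>)" if "x \<in> E \<rightarrow>\<^sub>E UNIV" for x
    using lip[OF that z0] by (simp add: z0_def)
  \<comment> \<open>A Lipschitz function grows at most linearly, so one integrable function
    dominates \<open>m\<close> at both the moved and the shifted disorder.\<close>
  have dom: "integrable (noise E) (\<lambda>\<omega>. \<bar>m z0\<bar> + (\<Sum>e\<in>E. \<bar>\<omega> (e, 0)\<bar> + s * \<bar>\<omega> (e, 1)\<bar>))"
    by (intro Bochner_Integration.integrable_add integrable_const Bochner_Integration.integrable_sum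
        integrable_mult_right integrable_abs integrable_noise_coordinate)
  have int_moved: "integrable (noise E) (\<lambda>\<omega>. m (moved E \<omega>))"
  proof (rule Bochner_Integration.integrable_bound[OF dom])
    have "\<bar>moved E \<omega> e\<bar> \<le> \<bar>\<omega> (e, 0)\<bar> + s * \<bar>\<omega> (e, 1)\<bar>" if "e \<in> E" for \<omega> e
      using that s_nonneg abs_triangle_ineq[of "\<omega> (e, 0)" "s * \<omega> (e, 1)"]
      by (auto simp: moved_def step_def abs_mult)
    then have "\<bar>m (moved E \<omega>)\<bar> \<le> \<bar>m z0\<bar> + (\<Sum>e\<in>E. \<bar>\<omega> (e, 0)\<bar> + s * \<bar>\<omega> (e, 1)\<bar>)" for \<omega>
      by (intro order_trans[OF grow[OF moved_PiE]] add_left_mono sum_mono)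
    then show "AE \<omega> in noise E. norm (m (moved E \<omega>)) \<le> norm (\<bar>m z0\<bar> + (\<Sum>e\<in>E. \<bar>\<omega> (e, 0)\<bar> + s * \<bar>\<omega> (e, 1)\<bar>))"
      by (intro AE_I2) (simp add: order_trans[OF _ abs_ge_self])
  qed (rule measurable_compose[OF moved_measurable m])
  have int_shift: "integrable (noise E) (\<lambda>\<omega>. m (shift (?\<pi> \<omega>)))"
  proof (rule Bochner_Integration.integrable_bound[OF dom])
    have "\<bar>shift (?\<pi> \<omega>) e\<bar> \<le> \<bar>\<omega> (e, 0)\<bar> + s * \<bar>\<omega> (e, 1)\<bar>" if "e \<in> E" for \<omega> e
      using that s_nonneg abs_triangle_ineq[of "\<omega> (e, 0)" "s * \<omega> (e, 1)"]
      by (auto simp: shift_def abs_mult)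
    then have "\<bar>m (shift (?\<pi> \<omega>))\<bar> \<le> \<bar>m z0\<bar> + (\<Sum>e\<in>E. \<bar>\<omega> (e, 0)\<bar> + s * \<bar>\<omega> (e, 1)\<bar>)" for \<omega>
      by (intro order_trans[OF grow[OF shift_PiE]] add_left_mono sum_mono)
    then show "AE \<omega> in noise E. norm (m (shift (?\<pi> \<omega>))) \<le> norm (\<bar>m z0\<bar> + (\<Sum>e\<in>E. \<bar>\<omega> (e, 0)\<bar> + s * \<bar>\<omega> (e, 1)\<bar>))"
      by (intro AE_I2) (simp add: order_trans[OF _ abs_ge_self])
  qed (rule measurable_compose[OF \<pi> mshift])
  have int_r: "integrable (noise E) (\<lambda>\<omega>. \<Sum>e\<in>E. r e \<omega>)"
    unfolding r_def by (intro Bochner_Integration.integrable_sum expected_rejection)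
  have E_r: "(\<integral>\<omega>. (\<Sum>e\<in>E. r e \<omega>) \<partial>noise E) \<le> card E * (C * s)"
  proof -
    have "(\<integral>\<omega>. (\<Sum>e\<in>E. r e \<omega>) \<partial>noise E) = (\<Sum>e\<in>E. \<integral>\<omega>. r e \<omega> \<partial>noise E)"
      unfolding r_def by (intro Bochner_Integration.integral_sum expected_rejection)
    also have "\<dots> \<le> (\<Sum>e\<in>E. C * s)"
      unfolding r_def by (intro sum_mono expected_rejection)
    finally show ?thesis by simp
  qed
  have pointwise: "m (moved E \<omega>) \<le> m (shift (?\<pi> \<omega>)) + s * (\<Sum>e\<in>E. r e \<omega>)" for \<omega>
  proof -
    have "\<bar>moved E \<omega> e - shift (?\<pi> \<omega>) e\<bar> = s * r e \<omega>" if "e \<in> E" for e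
      using that s_nonneg by (auto simp: moved_def shift_def step_def r_def abs_mult)
    then have "(\<Sum>e\<in>E. \<bar>moved E \<omega> e - shift (?\<pi> \<omega>) e\<bar>) = s * (\<Sum>e\<in>E. r e \<omega>)"
      by (simp add: sum_distrib_left)
    then show ?thesis using lip[OF moved_PiE[of \<omega>] shift_PiE[of "?\<pi> \<omega>"]] by linarith
  qed
  have D: "distr (noise E) (\<Pi>\<^sub>M e\<in>E. borel) (moved E) = ?P" by (rule distr_moved[OF E(2)])
  have D2: "distr (noise E) (?P \<Otimes>\<^sub>M gauss E) ?\<pi> = ?P \<Otimes>\<^sub>M gauss E" by (rule distr_noise_pair[OF E(2)])
  have "integrable (distr (noise E) (\<Pi>\<^sub>M e\<in>E. borel) (moved E)) m"
    using int_moved by (subst integrable_distr_eq[OF moved_measurable m])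
  then show "integrable ?P m" unfolding D .
  have "integrable (distr (noise E) (?P \<Otimes>\<^sub>M gauss E) ?\<pi>) (\<lambda>z. m (shift z))"
    using int_shift by (subst integrable_distr_eq[OF \<pi> mshift])
  then show "integrable (?P \<Otimes>\<^sub>M gauss E) (\<lambda>z. m (\<lambda>e\<in>E. fst z e + s * snd z e))"
    unfolding D2 shift_def .
  have "(\<integral>x. m x \<partial>?P) = (\<integral>\<omega>. m (moved E \<omega>) \<partial>noise E)"
    using integral_distr[OF moved_measurable m] unfolding D .
  also have "\<dots> \<le> (\<integral>\<omega>. m (shift (?\<pi> \<omega>)) + s * (\<Sum>e\<in>E. r e \<omega>) \<partial>noise E)"
    by (intro integral_mono int_moved Bochner_Integration.integrable_add int_shift integrable_mult_right int_r pointwise)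
  also have "\<dots> = (\<integral>\<omega>. m (shift (?\<pi> \<omega>)) \<partial>noise E) + s * (\<integral>\<omega>. (\<Sum>e\<in>E. r e \<omega>) \<partial>noise E)"
    using int_shift int_r by simp
  also have "(\<integral>\<omega>. m (shift (?\<pi> \<omega>)) \<partial>noise E) = (\<integral>z. m (shift z) \<partial>(?P \<Otimes>\<^sub>M gauss E))"
    using integral_distr[OF \<pi> mshift] unfolding D2 by simp
  also have "(\<integral>z. m (shift z) \<partial>(?P \<Otimes>\<^sub>M gauss E)) + s * (\<integral>\<omega>. (\<Sum>e\<in>E. r e \<omega>) \<partial>noise E)
      \<le> (\<integral>z. m (shift z) \<partial>(?P \<Otimes>\<^sub>M gauss E)) + s * (card E * (C * s))"
    by (intro add_left_mono mult_left_mono E_r s_nonneg)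
  finally show "(\<integral>x. m x \<partial>?P) \<le>
      (\<integral>z. m (\<lambda>e\<in>E. fst z e + s * snd z e) \<partial>(?P \<Otimes>\<^sub>M gauss E)) + s * (card E * (C * s))"
    unfolding shift_def .
qed

end

section \<open>Near-ground states of the Edwards--Anderson model\<close>

definition ground_energy :: "(int ^ 'd) set \<Rightarrow> ((int ^ 'd) set \<Rightarrow> real) \<Rightarrow> real" where
  "ground_energy \<Lambda> x = Min (EA_hamiltonian \<Lambda> x ` spin_configs \<Lambda>)"

section \<open>Lipschitz and measurable dependence of the energies on the disorder\<close>

lemma finite_spin_configs: "finite \<Lambda> \<Longrightarrow> finite (spin_configs \<Lambda>)"
  by (rule finite_subset[of _ "\<Lambda> \<rightarrow>\<^sub>E {1, -1}"]) (auto simp: spin_configs_def intro: finite_PiE)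

lemma spin_configs_nonempty: "spin_configs \<Lambda> \<noteq> {}" if "0 \<in> \<Lambda>"
proof -
  have "(\<lambda>i\<in>\<Lambda>. 1) \<in> spin_configs \<Lambda>" using that by (auto simp: spin_configs_def)
  then show ?thesis by blast
qed

lemma abs_bond:
  assumes "\<sigma> \<in> spin_configs \<Lambda>" "e \<in> edges \<Lambda>"
  shows "\<bar>\<Prod>k\<in>e. \<sigma> k\<bar> = 1"
proof -
  have "\<bar>\<sigma> k\<bar> = 1" if "k \<in> e" for k
    using assms that by (fastforce simp: spin_configs_def edges_def PiE_iff)
  then show ?thesis by (simp add: abs_prod)
qed

lemma EA_hamiltonian_cong:
  "(\<And>e. e \<in> edges \<Lambda> \<Longrightarrow> x e = y e) \<Longrightarrow> EA_hamiltonian \<Lambda> x = EA_hamiltonian \<Lambda> y"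
  by (auto simp: EA_hamiltonian_def fun_eq_iff)

lemma EA_hamiltonian_lipschitz:
  assumes "\<sigma> \<in> spin_configs \<Lambda>"
  shows "\<bar>EA_hamiltonian \<Lambda> x \<sigma> - EA_hamiltonian \<Lambda> y \<sigma>\<bar> \<le> (\<Sum>e\<in>edges \<Lambda>. \<bar>x e - y e\<bar>)"
proof -
  have "EA_hamiltonian \<Lambda> x \<sigma> - EA_hamiltonian \<Lambda> y \<sigma> = (\<Sum>e\<in>edges \<Lambda>. (y e - x e) * (\<Prod>k\<in>e. \<sigma> k))"
    by (simp add: EA_hamiltonian_def left_diff_distrib sum_subtractf)
  also have "\<bar>\<dots>\<bar> \<le> (\<Sum>e\<in>edges \<Lambda>. \<bar>(y e - x e) * (\<Prod>k\<in>e. \<sigma> k)\<bar>)"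
    by (rule sum_abs)
  also have "\<dots> = (\<Sum>e\<in>edges \<Lambda>. \<bar>x e - y e\<bar>)"
    by (intro sum.cong) (auto simp: abs_mult abs_bond[OF assms] abs_minus_commute)
  finally show ?thesis .
qed

lemma ground_energy_le:
  "finite \<Lambda> \<Longrightarrow> \<sigma> \<in> spin_configs \<Lambda> \<Longrightarrow> ground_energy \<Lambda> x \<le> EA_hamiltonian \<Lambda> x \<sigma>"
  unfolding ground_energy_def by (intro Min_le finite_imageI finite_spin_configs) auto

lemma ground_energy_attained:
  assumes "finite \<Lambda>" "0 \<in> \<Lambda>"
  obtains \<sigma> where "\<sigma> \<in> spin_configs \<Lambda>" "EA_hamiltonian \<Lambda> x \<sigma> = ground_energy \<Lambda> x"
proof -
  have "ground_energy \<Lambda> x \<in> EA_hamiltonian \<Lambda> x ` spin_configs \<Lambda>"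
    unfolding ground_energy_def
    by (intro Min_in finite_imageI finite_spin_configs assms) (simp add: spin_configs_nonempty assms)
  then show ?thesis using that by auto
qed

lemma ground_energy_lipschitz:
  assumes "finite \<Lambda>" "0 \<in> \<Lambda>"
  shows "\<bar>ground_energy \<Lambda> x - ground_energy \<Lambda> y\<bar> \<le> (\<Sum>e\<in>edges \<Lambda>. \<bar>x e - y e\<bar>)"
proof -
  have "ground_energy \<Lambda> x \<le> ground_energy \<Lambda> y + (\<Sum>e\<in>edges \<Lambda>. \<bar>x e - y e\<bar>)" for x y
  proof -
    obtain \<sigma> where \<sigma>: "\<sigma> \<in> spin_configs \<Lambda>" "EA_hamiltonian \<Lambda> y \<sigma> = ground_energy \<Lambda> y"
      using ground_energy_attained[OF assms] .
    show ?thesis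
      using ground_energy_le[OF assms(1) \<sigma>(1), of x] EA_hamiltonian_lipschitz[OF \<sigma>(1), of x y] \<sigma>(2)
      by linarith
  qed
  from this[of x y] this[of y x] show ?thesis
    by (simp add: abs_minus_commute[of "y _"] abs_le_iff)
qed

lemma EA_hamiltonian_measurable:
  assumes "finite \<Lambda>"
  shows "(\<lambda>x. EA_hamiltonian \<Lambda> x \<sigma>) \<in> borel_measurable (\<Pi>\<^sub>M e\<in>edges \<Lambda>. borel)"
  unfolding EA_hamiltonian_def
  by (intro borel_measurable_uminus borel_measurable_sum borel_measurable_times borel_measurable_const
      measurable_component_singleton)

lemma ground_energy_measurable:
  assumes "finite \<Lambda>"
  shows "ground_energy \<Lambda> \<in> borel_measurable (\<Pi>\<^sub>M e\<in>edges \<Lambda>. borel)"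
  unfolding ground_energy_def[abs_def]
  by (intro borel_measurable_Min finite_spin_configs EA_hamiltonian_measurable assms)

section \<open>Vertex degrees and the number of edges\<close>

definition lattice_degree :: "'d::finite itself \<Rightarrow> nat" where
  "lattice_degree _ = card {v :: int ^ 'd. (\<Sum>k\<in>UNIV. \<bar>v $ k\<bar>) = 1}"

text \<open>All entries lie between -1 and 1. Finiteness matters because \<open>card\<close> of an
  infinite set is 0, which would make \<open>lattice_degree\<close> worthless as a bound.\<close>

lemma finite_unit_vectors: "finite {v :: int ^ 'd. (\<Sum>k\<in>UNIV. \<bar>v $ k\<bar>) = 1}" (is "finite ?V")
proof (rule finite_imageD)
  have "\<bar>v $ k\<bar> \<le> 1" if "v \<in> ?V" for v k
    using member_le_sum[of k UNIV "\<lambda>k. \<bar>v $ k\<bar>"] that by simp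
  then have "vec_nth ` ?V \<subseteq> UNIV \<rightarrow>\<^sub>E {-1..1}"
    by (fastforce simp: PiE_iff abs_le_iff)
  then show "finite (vec_nth ` ?V)"
    by (rule finite_subset) (auto intro: finite_PiE)
  show "inj_on vec_nth ?V" by (auto simp: inj_on_def vec_nth_inject)
qed

lemma card_neighbours:
  fixes i :: "int ^ 'd::finite"
  shows "card {j \<in> \<Lambda>. neighbours j i} \<le> lattice_degree TYPE('d)"
  unfolding lattice_degree_def
proof (rule card_inj_on_le[of "\<lambda>j. j - i"])
  show "inj_on (\<lambda>j. j - i) {j \<in> \<Lambda>. neighbours j i}" by (auto simp: inj_on_def)
  show "(\<lambda>j. j - i) ` {j \<in> \<Lambda>. neighbours j i} \<subseteq> {v. (\<Sum>k\<in>UNIV. \<bar>v $ k\<bar>) = 1}"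
    by (auto simp: neighbours_def)
qed (rule finite_unit_vectors)

lemma card_vertex_block:
  fixes \<Lambda> :: "(int ^ 'd::finite) set"
  assumes "finite \<Lambda>"
  shows "card (vertex_block \<Lambda> i) \<le> lattice_degree TYPE('d)"
proof -
  have "vertex_block \<Lambda> i = (\<lambda>j. {i, j}) ` {j \<in> \<Lambda>. neighbours j i}"
    by (auto simp: vertex_block_def)
  then have "card (vertex_block \<Lambda> i) \<le> card {j \<in> \<Lambda>. neighbours j i}"
    using assms by (simp add: card_image_le)
  then show ?thesis using card_neighbours[of \<Lambda> i] by simp
qed

lemma card_edges:
  fixes \<Lambda> :: "(int ^ 'd::finite) set"
  assumes "finite \<Lambda>"
  shows "card (edges \<Lambda>) \<le> card \<Lambda> * lattice_degree TYPE('d)"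
proof -
  have "edges \<Lambda> = (\<Union>i\<in>\<Lambda>. vertex_block \<Lambda> i)"
    using perturbation_blocks_vertex[OF assms] by (simp add: perturbation_blocks_def)
  then have "card (edges \<Lambda>) \<le> (\<Sum>i\<in>\<Lambda>. card (vertex_block \<Lambda> i))"
    using card_UN_le[OF assms] by simp
  also have "\<dots> \<le> (\<Sum>i\<in>\<Lambda>. lattice_degree TYPE('d))"
    by (intro sum_mono card_vertex_block assms)
  finally show ?thesis by simp
qed

text \<open>The exceptional disorders; \<open>x\<close> is extensional because the set has to be an
  event of the product space over the edges.\<close>

definition many_near_ground_states ::
    "(int ^ 'd) set \<Rightarrow> real \<Rightarrow> real \<Rightarrow> nat \<Rightarrow> ((int ^ 'd) set \<Rightarrow> real) set" where
  "many_near_ground_states \<Lambda> \<epsilon> B K = {x \<in> edges \<Lambda> \<rightarrow>\<^sub>E UNIV. \<exists>U\<subseteq>spin_configs \<Lambda>.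
     K \<le> card U \<and> pairwise (\<lambda>\<sigma> \<tau>. \<epsilon> < EA_dist \<Lambda> \<sigma> \<tau>) U \<and>
     (\<forall>\<sigma>\<in>U. EA_hamiltonian \<Lambda> x \<sigma> \<le> ground_energy \<Lambda> x + B)}"

text \<open>The existential quantifier ranges over the finitely many subsets of a finite set, so the
  event is a finite union of finite intersections of measurable inequalities.\<close>

lemma many_near_ground_states_measurable:
  assumes "finite \<Lambda>"
  shows "many_near_ground_states \<Lambda> \<epsilon> B K \<in> sets (\<Pi>\<^sub>M e\<in>edges \<Lambda>. borel)"
proof -
  let ?M = "(\<Pi>\<^sub>M e\<in>edges \<Lambda>. borel) :: ((int ^ 'a) set \<Rightarrow> real) measure"
  let ?W = "{U \<in> Pow (spin_configs \<Lambda>). K \<le> card U \<and> pairwise (\<lambda>\<sigma> \<tau>. \<epsilon> < EA_dist \<Lambda> \<sigma> \<tau>) U}"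
  have fin: "finite ?W" using finite_spin_configs[OF assms] by simp
  have "{x \<in> space ?M. \<forall>\<sigma>\<in>U. EA_hamiltonian \<Lambda> x \<sigma> \<le> ground_energy \<Lambda> x + B} \<in> sets ?M" if "U \<in> ?W" for U
  proof (rule sets.sets_Collect_finite_All)
    show "finite U" using that finite_spin_configs[OF assms] by (auto dest: finite_subset)
    show "{x \<in> space ?M. EA_hamiltonian \<Lambda> x \<sigma> \<le> ground_energy \<Lambda> x + B} \<in> sets ?M" for \<sigma>
      by (intro borel_measurable_le borel_measurable_add borel_measurable_const
          EA_hamiltonian_measurable ground_energy_measurable assms)
  qed
  then have "(\<Union>U\<in>?W. {x \<in> space ?M. \<forall>\<sigma>\<in>U. EA_hamiltonian \<Lambda> x \<sigma> \<le> ground_energy \<Lambda> x + B}) \<in> sets ?M"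
    by (intro sets.finite_UN fin)
  also have "(\<Union>U\<in>?W. {x \<in> space ?M. \<forall>\<sigma>\<in>U. EA_hamiltonian \<Lambda> x \<sigma> \<le> ground_energy \<Lambda> x + B})
    = many_near_ground_states \<Lambda> \<epsilon> B K"
    by (auto simp: many_near_ground_states_def space_PiM)
  finally show ?thesis .
qed

text \<open>The Hamiltonian is linear in the disorder, so a Gaussian shift changes each energy by a
  centred Gaussian variable. The vectors on the right form the family to which
  \<open>gauss_supremum_unbounded\<close> is applied.\<close>

lemma EA_hamiltonian_shift:
  "EA_hamiltonian \<Lambda> (\<lambda>e\<in>edges \<Lambda>. x e + s * w e) \<sigma>
    = EA_hamiltonian \<Lambda> x \<sigma> - dot_on (edges \<Lambda>) (\<lambda>e. s * (\<Prod>k\<in>e. \<sigma> k)) w"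
  by (simp add: EA_hamiltonian_def dot_on_def sum.distrib[symmetric] algebra_simps)

text \<open>The scale \<open>s\<close> is the normalisation of \<open>EA_dist\<close>, so separated
  configurations give a separated Gaussian family.\<close>

lemma EA_dist_sq:
  fixes \<Lambda> :: "(int ^ 'd::finite) set"
  assumes "s = 1 / sqrt (card \<Lambda>)"
  shows "dot_on (edges \<Lambda>) (\<lambda>e. s * (\<Prod>k\<in>e. \<sigma> k) - s * (\<Prod>k\<in>e. \<tau> k)) (\<lambda>e. s * (\<Prod>k\<in>e. \<sigma> k) - s * (\<Prod>k\<in>e. \<tau> k))
    = (EA_dist \<Lambda> \<sigma> \<tau>)\<^sup>2"
proof -
  have s: "s * s = 1 / card \<Lambda>" using assms by simp
  have "dot_on (edges \<Lambda>) (\<lambda>e. s * (\<Prod>k\<in>e. \<sigma> k) - s * (\<Prod>k\<in>e. \<tau> k)) (\<lambda>e. s * (\<Prod>k\<in>e. \<sigma> k) - s * (\<Prod>k\<in>e. \<tau> k))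
    = (s * s) * (\<Sum>e\<in>edges \<Lambda>. ((\<Prod>k\<in>e. \<sigma> k) - (\<Prod>k\<in>e. \<tau> k))\<^sup>2)"
    by (simp add: dot_on_def sum_distrib_left power2_eq_square algebra_simps)
  also have "\<dots> = (EA_dist \<Lambda> \<sigma> \<tau>)\<^sup>2"
    unfolding s EA_dist_def by (subst real_sqrt_pow2) (auto intro!: divide_nonneg_nonneg sum_nonneg)
  finally show ?thesis .
qed

text \<open>For almost every disorder the Gaussian shift does not raise the mean ground energy, and
  on the exceptional set it lowers it by at least \<open>\<Psi> - B\<close>;
  \<open>metropolis_comparison\<close> limits the total decrease to \<open>C * D\<close>.
  \<open>K\<close> is fixed before \<open>\<Lambda>\<close>, hence uniform.\<close>

lemma near_ground_states_rare:
  fixes f :: "real \<Rightarrow> real" and \<epsilon> \<delta> B :: real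
  assumes f: "f \<in> borel_measurable borel" "\<And>x. 0 \<le> f x"
    and P: "P = density lborel (\<lambda>x. ennreal (f x))" "prob_space P" "integrable P (\<lambda>x. x)"
    and rej: "rejection_condition f"
    and pos: "0 < \<epsilon>" "0 < \<delta>"
  obtains K :: nat where
    "\<And>\<Lambda> :: (int ^ 'd::finite) set. finite \<Lambda> \<Longrightarrow> 0 \<in> \<Lambda> \<Longrightarrow> edges \<Lambda> \<noteq> {} \<Longrightarrow>
      measure (\<Pi>\<^sub>M e\<in>edges \<Lambda>. P) (many_near_ground_states \<Lambda> \<epsilon> B K) \<le> \<delta>"
proof -
  define D where "D = real (lattice_degree TYPE('d))"
  have D0: "0 \<le> D" by (simp add: D_def)
  from rej[unfolded rejection_condition_def, THEN spec, of 1, THEN mp, OF zero_le_one]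
  obtain C where C0: "0 < C" and C: "\<And>s. 0 \<le> s \<Longrightarrow>
        (\<integral>z. \<bar>snd z\<bar> powr 1 * max 0 (1 - f (fst z + s * snd z) / f (fst z))
          \<partial>(density lborel (\<lambda>x. ennreal (f x)) \<Otimes>\<^sub>M
             density lborel (\<lambda>x. ennreal (std_normal_density x)))) \<le> C * s"
    by blast
  \<comment> \<open>Then \<open>\<Psi> - B\<close> exceeds \<open>C * D / \<delta>\<close>, so a
    total decrease of at most \<open>C * D\<close> forces probability at most
    \<open>\<delta>\<close>; the \<open>+ 1\<close> makes the factor visibly positive.\<close>
  define \<Psi> where "\<Psi> = B + C * D / \<delta> + 1"
  obtain K :: nat where K: "\<forall>(I :: (int ^ 'd) set set) (U :: (int ^ 'd \<Rightarrow> real) set) v h.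
    finite I \<longrightarrow> finite U \<longrightarrow> K \<le> card U \<longrightarrow>
    (\<forall>k\<in>U. dot_on I (v k) (v k) \<le> D) \<longrightarrow>
    (\<forall>k\<in>U. \<forall>l\<in>U. k \<noteq> l \<longrightarrow> \<epsilon>\<^sup>2 \<le> dot_on I (\<lambda>e. v k e - v l e) (\<lambda>e. v k e - v l e)) \<longrightarrow>
    integrable (gauss I) h \<longrightarrow> (\<forall>w\<in>space (gauss I). \<forall>k\<in>U. dot_on I (v k) w \<le> h w) \<longrightarrow>
    \<Psi> \<le> (\<integral>w. h w \<partial>gauss I)"
    using gauss_supremum_unbounded[OF pos(1) D0] ..
  show ?thesis
  proof (rule that[of K])
    fix \<Lambda> :: "(int ^ 'd) set"
    assume \<Lambda>: "finite \<Lambda>" "0 \<in> \<Lambda>" and E: "edges \<Lambda> \<noteq> {}"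
    let ?E = "edges \<Lambda>" and ?m = "ground_energy \<Lambda>" and ?P = "\<Pi>\<^sub>M e\<in>edges \<Lambda>. P"
    define s where "s = 1 / sqrt (card \<Lambda>)"
    have N: "0 < real (card \<Lambda>)" using \<Lambda> by (auto simp: card_gt_0_iff)
    have ss: "s * s = 1 / card \<Lambda>" and s0: "0 \<le> s" by (auto simp: s_def)
    interpret metropolis f s C
      using f P(2,3) C[OF s0] s0 unfolding P(1) by (intro metropolis.intro)
    have law: "law = P" by (simp add: law_def P)
    have finE: "finite ?E" by (rule finite_edges[OF \<Lambda>(1)])
    have cardE: "card ?E / card \<Lambda> \<le> D"
    proof -
      have "real (card ?E) \<le> card \<Lambda> * D"
        using of_nat_mono[OF card_edges[OF \<Lambda>(1)], where 'a = real] by (simp add: D_def)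
      then show ?thesis using N by (simp add: divide_le_eq mult.commute)
    qed
    let ?shift = "\<lambda>z. \<lambda>e\<in>?E. fst z e + s * snd z e"
    note comp = metropolis_comparison[OF finE E ground_energy_measurable[OF \<Lambda>(1)]
        ground_energy_lipschitz[OF \<Lambda>], unfolded law]
    interpret P: prob_space ?P by (intro prob_space_PiM P)
    interpret G: prob_space "gauss ?E" by (rule prob_space_gauss)
    interpret PG: pair_sigma_finite ?P "gauss ?E"
      by (intro pair_sigma_finite.intro prob_space_imp_sigma_finite P.prob_space_axioms G.prob_space_axioms)
    define Gs where "Gs = many_near_ground_states \<Lambda> \<epsilon> B K"
    have "sets ?P = sets (\<Pi>\<^sub>M e\<in>?E. borel)" by (intro sets_PiM_cong) (auto simp: P)
    then have Gs: "Gs \<in> sets ?P"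
      using many_near_ground_states_measurable[OF \<Lambda>(1)] by (simp add: Gs_def)
    define v where "v \<sigma> = (\<lambda>e. s * (\<Prod>k\<in>e. \<sigma> k))" for \<sigma> :: "int ^ 'd \<Rightarrow> real"
    have shift_le: "?m (?shift (x, w)) \<le> EA_hamiltonian \<Lambda> x \<sigma> - dot_on ?E (v \<sigma>) w"
      if "\<sigma> \<in> spin_configs \<Lambda>" for x w \<sigma>
      unfolding v_def fst_conv snd_conv EA_hamiltonian_shift[symmetric]
      by (rule ground_energy_le[OF \<Lambda>(1) that])
    define I where "I x = (\<integral>w. ?m (?shift (x, w)) \<partial>gauss ?E)" for x
    have inner: "I x \<le> ?m x - (\<Psi> - B) * indicator Gs x"
      if int: "integrable (gauss ?E) (\<lambda>w. ?m (?shift (x, w)))" for x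
    proof (cases "x \<in> Gs")
      case True
      then obtain U where U: "U \<subseteq> spin_configs \<Lambda>" "K \<le> card U"
        "pairwise (\<lambda>\<sigma> \<tau>. \<epsilon> < EA_dist \<Lambda> \<sigma> \<tau>) U" "\<And>\<sigma>. \<sigma> \<in> U \<Longrightarrow> EA_hamiltonian \<Lambda> x \<sigma> \<le> ?m x + B"
        by (auto simp: Gs_def many_near_ground_states_def)
      \<comment> \<open>Each state in \<open>U\<close> has energy at most \<open>?m x + B\<close>
        before the shift and at least the shifted ground energy after it, so this integrand
        dominates every Gaussian variable of the family.\<close>
      have "\<Psi> \<le> (\<integral>w. ?m x + B - ?m (?shift (x, w)) \<partial>gauss ?E)"
      proof (rule K[rule_format, OF finE _ U(2)])
        show "finite U" using U(1) finite_spin_configs[OF \<Lambda>(1)] by (rule finite_subset)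
        show "dot_on ?E (v \<sigma>) (v \<sigma>) \<le> D" if "\<sigma> \<in> U" for \<sigma>
        proof -
          have "v \<sigma> e * v \<sigma> e = 1 / card \<Lambda>" if "e \<in> ?E" for e
          proof -
            have "(\<Prod>k\<in>e. \<sigma> k) * (\<Prod>k\<in>e. \<sigma> k) = 1"
              using abs_bond[OF subsetD[OF U(1) \<open>\<sigma> \<in> U\<close>] that] abs_mult_self_eq[of "\<Prod>k\<in>e. \<sigma> k"] by simp
            then show ?thesis using ss by (simp add: v_def algebra_simps)
          qed
          then have "dot_on ?E (v \<sigma>) (v \<sigma>) = card ?E / card \<Lambda>" by (simp add: dot_on_def)
          then show ?thesis using cardE by simp
        qed
        show "\<epsilon>\<^sup>2 \<le> dot_on ?E (\<lambda>e. v \<sigma> e - v \<tau> e) (\<lambda>e. v \<sigma> e - v \<tau> e)" if "\<sigma> \<in> U" "\<tau> \<in> U" "\<sigma> \<noteq> \<tau>" for \<sigma> \<tau>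
          unfolding v_def EA_dist_sq[OF s_def]
          using U(3) that pos(1) by (intro power_mono) (auto simp: pairwise_def less_imp_le)
        show "integrable (gauss ?E) (\<lambda>w. ?m x + B - ?m (?shift (x, w)))"
          by (intro Bochner_Integration.integrable_diff G.integrable_const int)
        show "dot_on ?E (v \<sigma>) w \<le> ?m x + B - ?m (?shift (x, w))" if "\<sigma> \<in> U" for w \<sigma>
          using shift_le[of \<sigma> x w] U(4)[OF that] that U(1) by auto
      qed
      also have "\<dots> = ?m x + B - I x"
        unfolding I_def using int by (simp add: G.prob_space)
      finally show ?thesis using True by simp
    next
      case False
      \<comment> \<open>Off the exceptional set one ground state of \<open>x\<close> serves as a
        trial state; its Gaussian correction has mean zero.\<close>
      obtain \<sigma> where \<sigma>: "\<sigma> \<in> spin_configs \<Lambda>" "EA_hamiltonian \<Lambda> x \<sigma> = ?m x"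
        using ground_energy_attained[OF \<Lambda>] .
      have "I x \<le> (\<integral>w. ?m x - dot_on ?E (v \<sigma>) w \<partial>gauss ?E)"
        unfolding I_def using shift_le[OF \<sigma>(1), of x] \<sigma>(2)
        by (intro integral_mono int Bochner_Integration.integrable_diff G.integrable_const integrable_gauss_dot_on) auto
      also have "\<dots> = ?m x"
        by (simp add: integrable_gauss_dot_on integral_gauss_dot_on G.prob_space)
      finally show ?thesis using False by simp
    qed
    have I_eq: "I = (\<lambda>x. \<integral>w. ?m (?shift (x, w)) \<partial>gauss ?E)" by (rule ext) (rule I_def)
    \<comment> \<open>Fubini's theorem gives integrability in \<open>w\<close> only for almost every
      \<open>x\<close>, so \<open>inner\<close> is available only almost everywhere.\<close>
    have fub: "AE x in ?P. integrable (gauss ?E) (\<lambda>w. ?m (?shift (x, w)))"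
      by (rule PG.AE_integrable_fst'[OF comp(2)])
    have int_I: "integrable ?P I"
      unfolding I_eq by (rule PG.integrable_fst'[OF comp(2)])
    have E_I: "(\<integral>x. I x \<partial>?P) = (\<integral>z. ?m (?shift z) \<partial>(?P \<Otimes>\<^sub>M gauss ?E))"
      unfolding I_eq by (rule PG.integral_fst'[OF comp(2)])
    have "(\<integral>x. I x \<partial>?P) \<le> (\<integral>x. ?m x - (\<Psi> - B) * indicator Gs x \<partial>?P)"
    proof (rule integral_mono_AE[OF int_I])
      show "integrable ?P (\<lambda>x. ?m x - (\<Psi> - B) * indicator Gs x)"
        by (intro Bochner_Integration.integrable_diff comp(1) integrable_mult_right integrable_real_indicator Gs)
          (simp add: P.emeasure_finite less_top[symmetric])
      show "AE x in ?P. I x \<le> ?m x - (\<Psi> - B) * indicator Gs x"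
        using fub by eventually_elim (rule inner)
    qed
    also have "\<dots> = (\<integral>x. ?m x \<partial>?P) - (\<Psi> - B) * measure ?P Gs"
      using comp(1) Gs by (subst Bochner_Integration.integral_diff) (auto simp: P.emeasure_finite less_top[symmetric])
    finally have "(\<Psi> - B) * measure ?P Gs \<le> s * (card ?E * (C * s))"
      using comp(3) E_I by linarith
    also have "\<dots> = (s * s) * card ?E * C" by simp
    also have "\<dots> = (card ?E / card \<Lambda>) * C" unfolding ss by simp
    also have "\<dots> \<le> C * D" using mult_right_mono[OF cardE, of C] C0 by (simp add: mult.commute)
    finally have "(C * D / \<delta> + 1) * measure ?P Gs \<le> C * D" by (simp add: \<Psi>_def)
    also have "\<dots> \<le> (C * D / \<delta> + 1) * \<delta>" using pos(2) by (simp add: distrib_right)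
    finally have "measure ?P Gs \<le> \<delta>"
      using C0 D0 pos(2) by (simp add: mult_le_cancel_left_pos add_nonneg_pos)
    then show "measure ?P (many_near_ground_states \<Lambda> \<epsilon> B K) \<le> \<delta>" by (simp add: Gs_def)
  qed
qed

section \<open>Stability under small perturbations\<close>

text \<open>A path from the origin to another site must leave the origin through an edge. This is
  what allows the joint law over the edges to be written as a product measure, and it yields a
  non-empty set of blocks.\<close>

lemma edges_nonempty:
  assumes "lattice_connected \<Lambda>" "0 \<in> \<Lambda>" "2 \<le> card \<Lambda>"
  shows "edges \<Lambda> \<noteq> {}"
proof -
  have "\<not> \<Lambda> \<subseteq> {0}"
    using assms(3) card_mono[of "{0}" \<Lambda>] by auto
  then obtain j where j: "j \<in> \<Lambda>" "j \<noteq> 0" by auto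
  then have "(0, j) \<in> {(a, b). a \<in> \<Lambda> \<and> b \<in> \<Lambda> \<and> neighbours a b}\<^sup>*"
    using assms by (simp add: lattice_connected_def)
  then obtain y where "y \<in> \<Lambda>" "neighbours 0 y"
    using j(2) by (auto elim: converse_rtranclE)
  then show ?thesis using assms(2) by (auto simp: edges_def)
qed

lemma packing_number_attained:
  assumes "finite T"
  obtains U where "U \<subseteq> T" "pairwise (\<lambda>x y. \<rho> x y > \<epsilon>) U" "card U = packing_number T \<rho> \<epsilon>"
proof -
  let ?S = "{card U | U. U \<subseteq> T \<and> pairwise (\<lambda>x y. \<rho> x y > \<epsilon>) U}"
  have "finite ?S"
    by (rule finite_subset[of _ "card ` Pow T"]) (use assms in auto)
  moreover have "card {} \<in> ?S" by (rule CollectI, rule exI[of _ "{}"]) simp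
  ultimately have "packing_number T \<rho> \<epsilon> \<in> ?S"
    unfolding packing_number_def by (intro Max_in) auto
  then show ?thesis using that by auto
qed

text \<open>Replacing the couplings in \<open>J\<close> changes the energy of any configuration by
  at most the sum over \<open>J\<close>. This is paid twice, once for the new minimizer and once for
  an old ground state.\<close>

lemma perturbed_minimizer_near_ground:
  fixes x y :: "(int ^ 'd::finite) set \<Rightarrow> real"
  assumes \<Lambda>: "finite \<Lambda>" "0 \<in> \<Lambda>" and J: "J \<subseteq> edges \<Lambda>"
  defines "\<tau> \<equiv> arg_min_on (EA_hamiltonian \<Lambda> (override_on x y J)) (spin_configs \<Lambda>)"
  shows "\<tau> \<in> spin_configs \<Lambda>"
    and "EA_hamiltonian \<Lambda> x \<tau> \<le> ground_energy \<Lambda> x + 2 * (\<Sum>e\<in>J. \<bar>x e - y e\<bar>)"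
proof -
  let ?z = "override_on x y J"
  note S = finite_spin_configs[OF \<Lambda>(1)] spin_configs_nonempty[OF \<Lambda>(2)]
  show \<tau>: "\<tau> \<in> spin_configs \<Lambda>" unfolding \<tau>_def by (rule arg_min_if_finite(1)[OF S])
  have "(\<Sum>e\<in>edges \<Lambda>. \<bar>x e - ?z e\<bar>) = (\<Sum>e\<in>J. \<bar>x e - ?z e\<bar>)"
    by (intro sum.mono_neutral_right finite_edges \<Lambda>(1) J) auto
  then have d: "(\<Sum>e\<in>edges \<Lambda>. \<bar>x e - ?z e\<bar>) = (\<Sum>e\<in>J. \<bar>x e - y e\<bar>)"
    by simp
  obtain \<sigma> where \<sigma>: "\<sigma> \<in> spin_configs \<Lambda>" "EA_hamiltonian \<Lambda> x \<sigma> = ground_energy \<Lambda> x"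
    using ground_energy_attained[OF \<Lambda>] .
  have "EA_hamiltonian \<Lambda> ?z \<tau> \<le> EA_hamiltonian \<Lambda> ?z \<sigma>"
    using arg_min_if_finite(2)[OF S, of "EA_hamiltonian \<Lambda> ?z"] \<sigma>(1) unfolding \<tau>_def by (meson not_less)
  then show "EA_hamiltonian \<Lambda> x \<tau> \<le> ground_energy \<Lambda> x + 2 * (\<Sum>e\<in>J. \<bar>x e - y e\<bar>)"
    using EA_hamiltonian_lipschitz[OF \<tau>, of x ?z] EA_hamiltonian_lipschitz[OF \<sigma>(1), of x ?z] \<sigma>(2)
    unfolding d by linarith
qed

text \<open>Markov's inequality for counting measure on \<open>L\<close>: a fraction
  \<open>\<epsilon>\<close> of values above \<open>B\<close> would already exhaust the sum.\<close>

lemma card_small_values: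
  fixes \<Delta> :: "'l \<Rightarrow> real" and B \<epsilon> :: real
  assumes L: "finite L" and \<Delta>: "\<And>l. l \<in> L \<Longrightarrow> 0 \<le> \<Delta> l" and B: "0 < B"
    and sum: "(\<Sum>l\<in>L. \<Delta> l) < \<epsilon> * B * card L"
  shows "(1 - \<epsilon>) * card L < card {l \<in> L. \<Delta> l \<le> B}"
proof -
  let ?A = "{l \<in> L. \<Delta> l \<le> B}"
  have "B * card (L - ?A) = (\<Sum>l\<in>L - ?A. B)" by simp
  also have "\<dots> \<le> (\<Sum>l\<in>L - ?A. \<Delta> l)" by (intro sum_mono) auto
  also have "\<dots> \<le> (\<Sum>l\<in>L. \<Delta> l)" by (intro sum_mono2 L) (auto simp: \<Delta>)
  also note sum
  finally have "B * card (L - ?A) < B * (\<epsilon> * card L)" by (simp add: mult_ac)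
  then have "card (L - ?A) < \<epsilon> * card L" using B by simp
  moreover have "card (L - ?A) = card L - card ?A" "card ?A \<le> card L"
    using L by (auto intro!: card_Diff_subset card_mono)
  ultimately show ?thesis by (simp add: of_nat_diff left_diff_distrib)
qed

lemma (in prob_space) independent_copy_component:
  assumes copy: "independent_copy M I X Y" and e: "e \<in> I"
  shows "X e \<in> borel_measurable M" "Y e \<in> borel_measurable M" "distr M borel (Y e) = distr M borel (X e)"
proof -
  let ?X = "\<lambda>\<omega>. \<lambda>e\<in>I. X e \<omega>" and ?Y = "\<lambda>\<omega>. \<lambda>e\<in>I. Y e \<omega>"
  have XY: "?X \<in> M \<rightarrow>\<^sub>M (\<Pi>\<^sub>M e\<in>I. borel)" "?Y \<in> M \<rightarrow>\<^sub>M (\<Pi>\<^sub>M e\<in>I. borel)"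
    using copy by (auto simp: independent_copy_def indep_var_distribution_eq)
  have c: "(\<lambda>x. x e) \<in> (\<Pi>\<^sub>M e\<in>I. borel) \<rightarrow>\<^sub>M borel"
    using e by (rule measurable_component_singleton)
  show "X e \<in> borel_measurable M" "Y e \<in> borel_measurable M"
    using measurable_compose[OF XY(1) c] measurable_compose[OF XY(2) c] e by simp_all
  have "distr M borel (Y e) = distr (distr M (\<Pi>\<^sub>M e\<in>I. borel) ?Y) borel (\<lambda>x. x e)"
    using e by (subst distr_distr[OF c XY(2)]) (simp add: comp_def)
  also have "distr M (\<Pi>\<^sub>M e\<in>I. borel) ?Y = distr M (\<Pi>\<^sub>M e\<in>I. borel) ?X"
    using copy by (simp add: independent_copy_def)
  also have "distr (distr M (\<Pi>\<^sub>M e\<in>I. borel) ?X) borel (\<lambda>x. x e) = distr M borel (X e)"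
    using e by (subst distr_distr[OF c XY(1)]) (simp add: comp_def)
  finally show "distr M borel (Y e) = distr M borel (X e)" .
qed

text \<open>By the triangle inequality each edge costs at most the mean moduli of \<open>X e\<close>
  and \<open>Y e\<close>, both of law \<open>P\<close>.\<close>

lemma (in prob_space) expected_perturbation:
  assumes copy: "independent_copy M I X Y" and J: "J \<subseteq> I" "finite J"
    and law: "\<And>e. e \<in> I \<Longrightarrow> distr M borel (X e) = P" and int: "integrable P (\<lambda>x :: real. x)"
  shows "integrable M (\<lambda>\<omega>. \<Sum>e\<in>J. \<bar>X e \<omega> - Y e \<omega>\<bar>)"
    and "expectation (\<lambda>\<omega>. \<Sum>e\<in>J. \<bar>X e \<omega> - Y e \<omega>\<bar>) \<le> card J * (2 * (\<integral>x. \<bar>x\<bar> \<partial>P))"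
proof -
  have *: "integrable M (\<lambda>\<omega>. \<bar>X e \<omega> - Y e \<omega>\<bar>)" (is ?i)
    "expectation (\<lambda>\<omega>. \<bar>X e \<omega> - Y e \<omega>\<bar>) \<le> 2 * (\<integral>x. \<bar>x\<bar> \<partial>P)" (is ?e) if "e \<in> J" for e
  proof -
    have e: "e \<in> I" using that J by auto
    note XY = independent_copy_component[OF copy e]
    have iX: "integrable M (X e)" and iY: "integrable M (Y e)"
      using integrable_distr[OF XY(1), of "\<lambda>x. x"] integrable_distr[OF XY(2), of "\<lambda>x. x"] XY(3) law[OF e] int
      by simp_all
    have "expectation (\<lambda>\<omega>. \<bar>X e \<omega>\<bar>) = (\<integral>x. \<bar>x\<bar> \<partial>P)" "expectation (\<lambda>\<omega>. \<bar>Y e \<omega>\<bar>) = (\<integral>x. \<bar>x\<bar> \<partial>P)"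
      using integral_distr[OF XY(1), of abs] integral_distr[OF XY(2), of abs] XY(3) law[OF e] by simp_all
    moreover have "expectation (\<lambda>\<omega>. \<bar>X e \<omega> - Y e \<omega>\<bar>) \<le> expectation (\<lambda>\<omega>. \<bar>X e \<omega>\<bar> + \<bar>Y e \<omega>\<bar>)"
      by (intro integral_mono integrable_abs Bochner_Integration.integrable_diff Bochner_Integration.integrable_add iX iY)
        (rule abs_triangle_ineq4)
    ultimately show ?e using iX iY by simp
    show ?i by (intro integrable_abs Bochner_Integration.integrable_diff iX iY)
  qed
  show "integrable M (\<lambda>\<omega>. \<Sum>e\<in>J. \<bar>X e \<omega> - Y e \<omega>\<bar>)"
    by (intro Bochner_Integration.integrable_sum *)
  have "expectation (\<lambda>\<omega>. \<Sum>e\<in>J. \<bar>X e \<omega> - Y e \<omega>\<bar>) = (\<Sum>e\<in>J. expectation (\<lambda>\<omega>. \<bar>X e \<omega> - Y e \<omega>\<bar>))"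
    by (intro Bochner_Integration.integral_sum *)
  also have "\<dots> \<le> (\<Sum>e\<in>J. 2 * (\<integral>x. \<bar>x\<bar> \<partial>P))" by (intro sum_mono *)
  finally show "expectation (\<lambda>\<omega>. \<Sum>e\<in>J. \<bar>X e \<omega> - Y e \<omega>\<bar>) \<le> card J * (2 * (\<integral>x. \<bar>x\<bar> \<partial>P))" by simp
qed

text \<open>Both families of blocks have sizes bounded uniformly in \<open>n\<close>, which is the
  role of \<open>D\<close>. The bad event is covered by \<open>E1\<close>, where the disorder has
  many near-ground states, and \<open>E2\<close>, where the perturbations are large in total; each
  has probability at most \<open>\<delta> / 2\<close>.\<close>

lemma EA_stable:
  fixes \<Lambda> :: "nat \<Rightarrow> (int ^ 'd::finite) set" and J :: "nat \<Rightarrow> 'l \<Rightarrow> (int ^ 'd) set set" and D :: nat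
  assumes \<Lambda>: "\<And>n. n \<ge> 1 \<Longrightarrow> finite (\<Lambda> n)" "\<And>n. n \<ge> 1 \<Longrightarrow> lattice_connected (\<Lambda> n)"
      "\<And>n. n \<ge> 1 \<Longrightarrow> 0 \<in> \<Lambda> n" "filterlim (\<lambda>n. card (\<Lambda> n)) at_top sequentially"
    and f: "f \<in> borel_measurable borel" "\<And>x. f x \<ge> 0"
    and P: "P = density lborel (\<lambda>x. ennreal (f x))" "prob_space P" "integrable P (\<lambda>x. x)"
    and rej: "rejection_condition f"
    and M: "\<And>n. n \<ge> 1 \<Longrightarrow> prob_space (M n)"
    and ind: "\<And>n. n \<ge> 1 \<Longrightarrow> prob_space.indep_vars (M n) (\<lambda>_. borel) (X n) (edges (\<Lambda> n))"
    and law: "\<And>n e. n \<ge> 1 \<Longrightarrow> e \<in> edges (\<Lambda> n) \<Longrightarrow> distr (M n) borel (X n e) = P"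
    and L: "\<And>n. n \<ge> 1 \<Longrightarrow> finite (L n)" "\<And>n. n \<ge> 1 \<Longrightarrow> edges (\<Lambda> n) \<noteq> {} \<Longrightarrow> L n \<noteq> {}"
    and J: "\<And>n l. n \<ge> 1 \<Longrightarrow> l \<in> L n \<Longrightarrow> J n l \<subseteq> edges (\<Lambda> n)"
      "\<And>n l. n \<ge> 1 \<Longrightarrow> l \<in> L n \<Longrightarrow> card (J n l) \<le> D"
    and copy: "\<And>n l. n \<ge> 1 \<Longrightarrow> l \<in> L n \<Longrightarrow> independent_copy (M n) (edges (\<Lambda> n)) (X n) (Y n l)"
  shows "stable_under_small_perturbations M (\<lambda>n. spin_configs (\<Lambda> n)) (\<lambda>n. EA_dist (\<Lambda> n))
    (\<lambda>n. EA_hamiltonian (\<Lambda> n)) X L J Y"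
  unfolding stable_under_small_perturbations_def Let_def
proof (intro allI impI)
  fix \<epsilon> \<delta> :: real assume pos: "0 < \<epsilon>" "0 < \<delta>"
  let ?opt = "\<lambda>n l \<omega>. arg_min_on (EA_hamiltonian (\<Lambda> n) (override_on (\<lambda>e. X n e \<omega>) (\<lambda>e. Y n l e \<omega>) (J n l)))
    (spin_configs (\<Lambda> n))"
  let ?pack = "\<lambda>n \<omega>. Min {packing_number ((\<lambda>l. ?opt n l \<omega>) ` A) (EA_dist (\<Lambda> n)) \<epsilon> |A.
    A \<subseteq> L n \<and> (1 - \<epsilon>) * real (card (L n)) < real (card A)}"
  define m1 where "m1 = (\<integral>x. \<bar>x\<bar> \<partial>P)"
  have m1: "0 \<le> m1" by (simp add: m1_def)
  \<comment> \<open>Markov's inequality will bound the probability of \<open>E2\<close> by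
    \<open>2 * D * m1 / (\<epsilon> * B)\<close>, which this choice keeps below
    \<open>\<delta> / 2\<close>; the \<open>+ 1\<close> ensures \<open>B > 0\<close> even if
    \<open>D\<close> or \<open>m1\<close> is 0.\<close>
  define B where "B = 4 * D * m1 / (\<epsilon> * \<delta>) + 1"
  have B: "0 < B" using m1 pos by (simp add: B_def add_nonneg_pos)
  \<comment> \<open>A perturbation of total size \<open>B\<close> raises the energy of the minimizer
    by up to \<open>2 * B\<close>.\<close>
  obtain K :: nat where K: "\<And>\<Lambda> :: (int ^ 'd) set. finite \<Lambda> \<Longrightarrow> 0 \<in> \<Lambda> \<Longrightarrow> edges \<Lambda> \<noteq> {} \<Longrightarrow>
      measure (\<Pi>\<^sub>M e\<in>edges \<Lambda>. P) (many_near_ground_states \<Lambda> \<epsilon> (2 * B) K) \<le> \<delta> / 2"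
    using near_ground_states_rare[OF f P rej pos(1), of "\<delta> / 2" "2 * B"] pos(2) by auto
  have bound: "measure (M n) {\<omega> \<in> space (M n). real K \<le> real (?pack n \<omega>)} \<le> \<delta>"
    if n: "n \<ge> 1" and card: "2 \<le> card (\<Lambda> n)" for n
  proof -
    interpret M: prob_space "M n" by (rule M[OF n])
    let ?E = "edges (\<Lambda> n)"
    have E: "?E \<noteq> {}" by (rule edges_nonempty[OF \<Lambda>(2)[OF n] \<Lambda>(3)[OF n] card])
    define G where "G = many_near_ground_states (\<Lambda> n) \<epsilon> (2 * B) K"
    define \<Delta> where "\<Delta> l = (\<lambda>\<omega>. \<Sum>e\<in>J n l. \<bar>X n e \<omega> - Y n l e \<omega>\<bar>)" for l
    \<comment> \<open>Restriction to the edges places the disorder in the product space of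
      \<open>G\<close>; \<open>xH\<close> below records that the energies do not notice it.\<close>
    define x where "x \<omega> = (\<lambda>e\<in>?E. X n e \<omega>)" for \<omega>
    define E1 where "E1 = x -` G \<inter> space (M n)"
    define E2 where "E2 = {\<omega> \<in> space (M n). \<epsilon> * B * card (L n) \<le> (\<Sum>l\<in>L n. \<Delta> l \<omega>)}"
    have finJ: "finite (J n l)" if "l \<in> L n" for l
      using J(1)[OF n that] finite_edges[OF \<Lambda>(1)[OF n]] by (rule finite_subset)
    have rv: "X n e \<in> borel_measurable (M n)" if "e \<in> ?E" for e
      using ind[OF n] that by (auto simp: M.indep_vars_def)
    have x: "x \<in> M n \<rightarrow>\<^sub>M (\<Pi>\<^sub>M e\<in>?E. borel)"
      unfolding x_def by (intro measurable_restrict rv)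
    have G: "G \<in> sets (\<Pi>\<^sub>M e\<in>?E. borel)"
      unfolding G_def by (rule many_near_ground_states_measurable[OF \<Lambda>(1)[OF n]])
    have E1: "E1 \<in> sets (M n)" unfolding E1_def by (rule measurable_sets[OF x G])
    have "distr (M n) (\<Pi>\<^sub>M e\<in>?E. borel) x = (\<Pi>\<^sub>M e\<in>?E. distr (M n) borel (X n e))"
      using M.indep_vars_iff_distr_eq_PiM'[OF E, where M' = "\<lambda>_. borel" and X = "X n"] rv ind[OF n]
      unfolding x_def by blast
    also have "\<dots> = (\<Pi>\<^sub>M e\<in>?E. P)" by (intro PiM_cong refl law[OF n])
    finally have "measure (M n) E1 = measure (\<Pi>\<^sub>M e\<in>?E. P) G"
      unfolding E1_def using measure_distr[OF x G] by simp
    then have P1: "measure (M n) E1 \<le> \<delta> / 2"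
      unfolding G_def using K[OF \<Lambda>(1)[OF n] \<Lambda>(3)[OF n] E] by simp
    have \<Delta>_int: "integrable (M n) (\<Delta> l)" "(\<integral>\<omega>. \<Delta> l \<omega> \<partial>M n) \<le> card (J n l) * (2 * m1)" if "l \<in> L n" for l
      using M.expected_perturbation[OF copy[OF n that] J(1)[OF n that] finJ[OF that] law[OF n] P(3)]
      by (simp_all add: \<Delta>_def m1_def)
    have sum_int: "integrable (M n) (\<lambda>\<omega>. \<Sum>l\<in>L n. \<Delta> l \<omega>)"
      by (intro Bochner_Integration.integrable_sum \<Delta>_int(1))
    have E2: "E2 \<in> sets (M n)"
      unfolding E2_def by (intro borel_measurable_le borel_measurable_const borel_measurable_integrable sum_int)
    have P2: "measure (M n) E2 \<le> \<delta> / 2"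
    proof -
      have cL: "0 < real (card (L n))"
        using L(1)[OF n] L(2)[OF n E] by (simp add: card_gt_0_iff)
      have c: "0 < \<epsilon> * B * card (L n)" using pos B cL by simp
      \<comment> \<open>Linearity of expectation needs only the law of each single perturbation, as
        nothing is assumed about the joint law of the copies.\<close>
      have "(\<integral>\<omega>. (\<Sum>l\<in>L n. \<Delta> l \<omega>) \<partial>M n) = (\<Sum>l\<in>L n. \<integral>\<omega>. \<Delta> l \<omega> \<partial>M n)"
        by (intro Bochner_Integration.integral_sum \<Delta>_int(1))
      also have "\<dots> \<le> (\<Sum>l\<in>L n. D * (2 * m1))"
      proof (rule sum_mono)
        fix l assume l: "l \<in> L n"
        have "card (J n l) * (2 * m1) \<le> D * (2 * m1)"
          using J(2)[OF n l] m1 by (intro mult_right_mono) auto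
        then show "(\<integral>\<omega>. \<Delta> l \<omega> \<partial>M n) \<le> D * (2 * m1)" using \<Delta>_int(2)[OF l] by linarith
      qed
      finally have mean: "(\<integral>\<omega>. (\<Sum>l\<in>L n. \<Delta> l \<omega>) \<partial>M n) \<le> card (L n) * (D * (2 * m1))" by simp
      have "measure (M n) E2 \<le> (\<integral>\<omega>. (\<Sum>l\<in>L n. \<Delta> l \<omega>) \<partial>M n) / (\<epsilon> * B * card (L n))"
        unfolding E2_def by (rule integral_Markov_inequality_measure[OF sum_int, of "{}"])
          (use c in \<open>auto simp: \<Delta>_def intro!: sum_nonneg\<close>)
      also have "\<dots> \<le> card (L n) * (D * (2 * m1)) / (\<epsilon> * B * card (L n))"
        using mean c by (intro divide_right_mono) auto
      also have "\<dots> = 2 * D * m1 / (\<epsilon> * B)"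
        using cL by simp
      also have "\<dots> \<le> \<delta> / 2"
      proof -
        have "\<epsilon> * B * \<delta> = 4 * D * m1 + \<epsilon> * \<delta>"
          using pos by (simp add: B_def field_simps)
        then have "2 * D * m1 \<le> \<delta> / 2 * (\<epsilon> * B)" using mult_pos_pos[OF pos] by (simp add: mult_ac)
        then show ?thesis using pos B by (simp add: pos_divide_le_eq)
      qed
      finally show ?thesis .
    qed
    \<comment> \<open>Off \<open>E2\<close>, the blocks with perturbation at most \<open>B\<close>
      form an admissible \<open>A\<close>. The minimum is at most the packing number of this
      \<open>A\<close>, so \<open>K\<close> separated minimizers occur there, all of them
      near-ground states of the unperturbed disorder.\<close>
    have "{\<omega> \<in> space (M n). real K \<le> real (?pack n \<omega>)} \<subseteq> E1 \<union> E2"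
    proof safe
      fix \<omega> assume \<omega>: "\<omega> \<in> space (M n)" and big: "real K \<le> real (?pack n \<omega>)" and "\<omega> \<notin> E2"
      define A where "A = {l \<in> L n. \<Delta> l \<omega> \<le> B}"
      have "(1 - \<epsilon>) * card (L n) < card A"
        unfolding A_def using \<open>\<omega> \<notin> E2\<close> \<omega>
        by (intro card_small_values[OF L(1)[OF n] _ B]) (auto simp: E2_def \<Delta>_def intro!: sum_nonneg)
      then have "packing_number ((\<lambda>l. ?opt n l \<omega>) ` A) (EA_dist (\<Lambda> n)) \<epsilon> \<in>
        {packing_number ((\<lambda>l. ?opt n l \<omega>) ` A) (EA_dist (\<Lambda> n)) \<epsilon> |A.
          A \<subseteq> L n \<and> (1 - \<epsilon>) * real (card (L n)) < real (card A)}" (is "_ \<in> ?S")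
        by (auto simp: A_def)
      moreover have "finite ?S"
        by (rule finite_subset[of _ "(\<lambda>A. packing_number ((\<lambda>l. ?opt n l \<omega>) ` A) (EA_dist (\<Lambda> n)) \<epsilon>) ` Pow (L n)"])
          (use L(1)[OF n] in auto)
      ultimately have "?pack n \<omega> \<le> packing_number ((\<lambda>l. ?opt n l \<omega>) ` A) (EA_dist (\<Lambda> n)) \<epsilon>"
        by (intro Min_le)
      moreover obtain U where U: "U \<subseteq> (\<lambda>l. ?opt n l \<omega>) ` A" "pairwise (\<lambda>\<sigma> \<tau>. \<epsilon> < EA_dist (\<Lambda> n) \<sigma> \<tau>) U"
        "card U = packing_number ((\<lambda>l. ?opt n l \<omega>) ` A) (EA_dist (\<Lambda> n)) \<epsilon>"
        by (rule packing_number_attained[of "(\<lambda>l. ?opt n l \<omega>) ` A" \<epsilon> "EA_dist (\<Lambda> n)"])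
          (use L(1)[OF n] in \<open>auto simp: A_def\<close>)
      ultimately have "K \<le> card U" using big by linarith
      moreover have xH: "EA_hamiltonian (\<Lambda> n) (x \<omega>) = EA_hamiltonian (\<Lambda> n) (\<lambda>e. X n e \<omega>)"
        by (rule EA_hamiltonian_cong) (simp add: x_def)
      have near: "\<sigma> \<in> spin_configs (\<Lambda> n) \<and> EA_hamiltonian (\<Lambda> n) (x \<omega>) \<sigma> \<le> ground_energy (\<Lambda> n) (x \<omega>) + 2 * B"
        if "\<sigma> \<in> U" for \<sigma>
      proof -
        obtain l where l: "l \<in> L n" "\<Delta> l \<omega> \<le> B" "\<sigma> = ?opt n l \<omega>"
          using U(1) \<open>\<sigma> \<in> U\<close> by (auto simp: A_def)
        show ?thesis
          using perturbed_minimizer_near_ground[OF \<Lambda>(1)[OF n] \<Lambda>(3)[OF n] J(1)[OF n l(1)],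
              of "\<lambda>e. X n e \<omega>" "\<lambda>e. Y n l e \<omega>"] l(2)
          unfolding l(3) ground_energy_def xH \<Delta>_def by linarith
      qed
      ultimately have "x \<omega> \<in> G"
        unfolding G_def many_near_ground_states_def using U(2) by (auto simp: x_def)
      then show "\<omega> \<in> E1" using \<omega> by (simp add: E1_def)
    qed
    then have "measure (M n) {\<omega> \<in> space (M n). real K \<le> real (?pack n \<omega>)} \<le> measure (M n) (E1 \<union> E2)"
      using E1 E2 by (intro M.finite_measure_mono) auto
    also have "\<dots> \<le> measure (M n) E1 + measure (M n) E2"
      by (intro measure_Un_le E1 E2)
    finally show ?thesis using P1 P2 by simp
  qed
  have "eventually (\<lambda>n. 2 \<le> card (\<Lambda> n)) sequentially"
    using \<Lambda>(4) by (simp add: filterlim_at_top)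
  \<comment> \<open>The bound holds for every \<open>n \<ge> 1\<close> with at least two sites,
    hence eventually, and it passes to the limsup with \<open>real K\<close> as the witness.\<close>
  then have "eventually (\<lambda>n. ereal (measure (M n) {\<omega> \<in> space (M n). real K \<le> real (?pack n \<omega>)}) \<le> ereal \<delta>) sequentially"
    using eventually_ge_at_top[of 1] by eventually_elim (simp only: ereal_less_eq bound)
  then show "\<exists>K. limsup (\<lambda>n. ereal (measure (M n) {\<omega> \<in> space (M n). K \<le> real (?pack n \<omega>)})) \<le> ereal \<delta>"
    by (intro exI[of _ "real K"] Limsup_bounded)
qed

theorem theorem3p3p2:
  fixes \<Lambda> :: "nat \<Rightarrow> (int ^ 'd::finite) set"
    and M :: "nat \<Rightarrow> 'w measure"
    and X :: "nat \<Rightarrow> (int ^ 'd) set \<Rightarrow> 'w \<Rightarrow> real"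
    and P :: "real measure"
    and f :: "real \<Rightarrow> real"
  assumes "\<And>n. n \<ge> 1 \<Longrightarrow> finite (\<Lambda> n)"
    and "\<And>n. n \<ge> 1 \<Longrightarrow> lattice_connected (\<Lambda> n)"
    and "\<And>n. n \<ge> 1 \<Longrightarrow> 0 \<in> \<Lambda> n"
    and "filterlim (\<lambda>n. card (\<Lambda> n)) at_top sequentially"
    and "f \<in> borel_measurable borel"
    and "\<And>x. f x \<ge> 0"
    and "P = density lborel (\<lambda>x. ennreal (f x))"
    and "prob_space P"
    and "integrable P (\<lambda>x. x)"
    and "(\<integral>x. x \<partial>P) = 0"
    and "rejection_condition f"
    and "\<And>n. n \<ge> 1 \<Longrightarrow> prob_space (M n)"
    and "\<And>n. n \<ge> 1 \<Longrightarrow> prob_space.indep_vars (M n) (\<lambda>_. borel) (X n) (edges (\<Lambda> n))"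
    and "\<And>n e. n \<ge> 1 \<Longrightarrow> e \<in> edges (\<Lambda> n) \<Longrightarrow> distr (M n) borel (X n e) = P"
  shows
    "(\<forall>Y. (\<forall>n\<ge>1. \<forall>e\<in>edges (\<Lambda> n). independent_copy (M n) (edges (\<Lambda> n)) (X n) (Y n e)) \<longrightarrow>
        stable_under_small_perturbations M
          (\<lambda>n. spin_configs (\<Lambda> n)) (\<lambda>n. EA_dist (\<Lambda> n)) (\<lambda>n. EA_hamiltonian (\<Lambda> n)) X
          (\<lambda>n. edges (\<Lambda> n)) (\<lambda>n. edge_block) Y) \<and>
     (\<forall>Y. (\<forall>n\<ge>1. \<forall>i\<in>\<Lambda> n. independent_copy (M n) (edges (\<Lambda> n)) (X n) (Y n i)) \<longrightarrow>
        stable_under_small_perturbations M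
          (\<lambda>n. spin_configs (\<Lambda> n)) (\<lambda>n. EA_dist (\<Lambda> n)) (\<lambda>n. EA_hamiltonian (\<Lambda> n)) X
          \<Lambda> (\<lambda>n. vertex_block (\<Lambda> n)) Y)"
proof -
  note stable = EA_stable[OF assms(1-9) assms(11-14)]
  show ?thesis
  proof (intro conjI allI impI)
    fix Y :: "nat \<Rightarrow> (int ^ 'd) set \<Rightarrow> (int ^ 'd) set \<Rightarrow> 'w \<Rightarrow> real"
    assume "\<forall>n\<ge>1. \<forall>e\<in>edges (\<Lambda> n). independent_copy (M n) (edges (\<Lambda> n)) (X n) (Y n e)"
    then show "stable_under_small_perturbations M
            (\<lambda>n. spin_configs (\<Lambda> n)) (\<lambda>n. EA_dist (\<Lambda> n)) (\<lambda>n. EA_hamiltonian (\<Lambda> n)) X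
            (\<lambda>n. edges (\<Lambda> n)) (\<lambda>n. edge_block) Y"
      by (intro stable[where D = 1]) (auto simp: edge_block_def finite_edges[OF assms(1)])
  next
    fix Y :: "nat \<Rightarrow> int ^ 'd \<Rightarrow> (int ^ 'd) set \<Rightarrow> 'w \<Rightarrow> real"
    assume copy: "\<forall>n\<ge>1. \<forall>i\<in>\<Lambda> n. independent_copy (M n) (edges (\<Lambda> n)) (X n) (Y n i)"
    show "stable_under_small_perturbations M
            (\<lambda>n. spin_configs (\<Lambda> n)) (\<lambda>n. EA_dist (\<Lambda> n)) (\<lambda>n. EA_hamiltonian (\<Lambda> n)) X
            \<Lambda> (\<lambda>n. vertex_block (\<Lambda> n)) Y"
    proof (rule stable[where D = "lattice_degree TYPE('d)"])
      fix n :: nat assume n: "n \<ge> 1"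
      show "finite (\<Lambda> n)" by (rule assms(1)[OF n])
      show "\<Lambda> n \<noteq> {}" using assms(3)[OF n] by auto
      fix i assume i: "i \<in> \<Lambda> n"
      show "vertex_block (\<Lambda> n) i \<subseteq> edges (\<Lambda> n)"
        using perturbation_blocks_vertex[OF assms(1)[OF n]] i by (auto simp: perturbation_blocks_def)
      show "card (vertex_block (\<Lambda> n) i) \<le> lattice_degree TYPE('d)"
        by (rule card_vertex_block[OF assms(1)[OF n]])
      show "independent_copy (M n) (edges (\<Lambda> n)) (X n) (Y n i)"
        using copy n i by blast
    qed
  qed
qed

end
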